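(* Let $A$ be an algebra in an abelian monoidal category $(\mathcal{M},\otimes,\mathbf{1})$ and let $M$ be an $(A,A)$-bimodule in $\mathcal{M}$. The map $$\Phi:\mathbf{H}^2(A,M)\to\mathrm{Ext}(A,M),\qquad \Phi([\omega]):=[E_\omega],$$ from the second Hochschild cohomology group to the set of equivalence classes of Hochschild extensions of $A$ with kernel $M$, is well defined and is a bijection.
   Context: $(\mathcal{M},\otimes,\mathbf{1})$ is a monoidal category with $\mathcal{M}$ abelian; constraints are suppressed, and in composites an object denotes its identity morphism. $(A,m,u)$ is an algebra in $\mathcal{M}$; $M$ has actions $\mu_l:A\otimes M\to M$, $\mu_r:M\otimes A\to M$. Hochschild cohomology is $\mathbf{H}^\bullet(A,M)=\mathbf{Ext}_{\mathcal{E}}^\bullet(A,M)$, the relative Ext in the category ${}_A\mathcal{M}_A$ of $(A,A)$-bimodules with respect to the class $\mathcal{E}$ of bimodule epimorphisms that split in $\mathcal{M}$; it is the cohomology of the standard complex $\mathcal{M}(\mathbf{1},M)\to\mathcal{M}(A,M)\xrightarrow{b^1}\mathcal{M}(A\otimes A,M)\xrightarrow{b^2}\mathcal{M}(A\otimes A\otimes A,M)\to\cdots$. In particular $\mathbf{H}^2(A,M)=\mathrm{Ker}\,b^2/\mathrm{Im}\,b^1$, where $b^1(f)=\mu_l(A\otimes f)-fm+\mu_r(f\otimes A)$ and $b^2(f)=\mu_l(A\otimes f)-f(m\otimes A)+f(A\otimes m)-\mu_r(f\otimes A)$. Elements of $\mathrm{Ker}\,b^2$ are called 2-cocycles. A Hochschild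 extension of $A$ with kernel $M$ is an algebra homomorphism $\pi:E\to A$ in $\mathcal M$ such that: $\pi$ has a section $\sigma$ in $\mathcal{M}$; there is a morphism $i:M\to E$ such that $(M,i)$ is the kernel of $\pi$ in $\mathcal{M}$; $m_E(i\otimes i)=0$, where $m_E$ is the multiplication of $E$; and the bimodule structure of $M$ coincides with the induced one, i.e. $i\mu_l=m_E(\sigma\otimes i)$, $i\mu_r=m_E(i\otimes\sigma)$ (this is independent of the choice of $\sigma$). Two Hochschild extensions $\pi:E\to A$ and $\pi':E'\to A$ of $A$ with kernel $M$ are equivalent if there is a morphism of algebras $f:E\to E'$ such that $\pi'f=\pi$ and the restriction $f':\mathrm{Ker}\,\pi\to\mathrm{Ker}\,\pi'$ of $f$ is an isomorphism in $\mathcal{M}$. $\mathrm{Ext}(A,M)$ is the set of equivalence classes $[E]$. For a 2-cocycle $\omega:A\otimes A\to M$, $E_\omega$ is the object $A\oplus M$, with injections $i_A,i_M$ and projections $p_A,p_M$, with multiplication $i_Am(p_A\otimes p_A)+i_M[\mu_r(p_M\otimes p_A)+\mu_l(p_A\otimes p_M)-\omega(p_A\otimes p_A)]$ and unit $i_Au+i_M\omega(u\otimes u)$ (where $\mathbf 1\cong\mathbf 1\otimes\mathbf 1$); together with $p_A:E_\omega\to A$, it is a Hochschild extension of $A$ with kernel $(M,i_M)$.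
   Formalization: Extensions carry the kernel inclusion i, and equivalence requires f i = i' (identity on M), since allowing any isomorphism of kernels identifies E_ω with E_{−ω} and breaks injectivity; the tensor product is assumed additive in each variable. *)

theory Defs
  imports "HOL-Algebra.Coset"
begin

section \<open>Abelian monoidal categories\<close>

text \<open>
  The constraints have the types
  \<open>assoc X Y Z : (X \<odot> Y) \<odot> Z \<rightarrow> X \<odot> (Y \<odot> Z)\<close>, \<open>lunit X : \<I> \<odot> X \<rightarrow> X\<close> and
  \<open>runit X : X \<odot> \<I> \<rightarrow> X\<close>; the category is not assumed to be strict. In an abelian category
  \<open>Add\<close> and \<open>Zero\<close> are determined by the underlying category.
\<close>

record ('o, 'a) mon_cat =
  Obj :: "'o set"
  Arr :: "'a set"
  Dom :: "'a \<Rightarrow> 'o"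
  Cod :: "'a \<Rightarrow> 'o"
  ident :: "'o \<Rightarrow> 'a"
  Comp :: "'a \<Rightarrow> 'a \<Rightarrow> 'a" (infixl \<open>\<cdot>\<index>\<close> 70)
  Add :: "'a \<Rightarrow> 'a \<Rightarrow> 'a" (infixl \<open>\<oplus>\<index>\<close> 65)
  Zero :: "'o \<Rightarrow> 'o \<Rightarrow> 'a"
  tensor_obj :: "'o \<Rightarrow> 'o \<Rightarrow> 'o" (infixl \<open>\<odot>\<index>\<close> 75)
  tensor :: "'a \<Rightarrow> 'a \<Rightarrow> 'a" (infixl \<open>\<boxtimes>\<index>\<close> 75)
  unit_obj :: "'o" (\<open>\<I>\<index>\<close>)
  assoc :: "'o \<Rightarrow> 'o \<Rightarrow> 'o \<Rightarrow> 'a"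
  lunit :: "'o \<Rightarrow> 'a"
  runit :: "'o \<Rightarrow> 'a"

definition Hom :: "('o, 'a) mon_cat \<Rightarrow> 'o \<Rightarrow> 'o \<Rightarrow> 'a set" where
  "Hom C X Y = {f \<in> Arr C. Dom C f = X \<and> Cod C f = Y}"

definition hom_group :: "('o, 'a) mon_cat \<Rightarrow> 'o \<Rightarrow> 'o \<Rightarrow> 'a monoid" where
  "hom_group C X Y = \<lparr>carrier = Hom C X Y, mult = Add C, one = Zero C X Y\<rparr>"

definition Diff :: "('o, 'a) mon_cat \<Rightarrow> 'a \<Rightarrow> 'a \<Rightarrow> 'a" (infixl \<open>\<ominus>\<index>\<close> 65) where
  "f \<ominus>\<^bsub>C\<^esub> g = f \<oplus>\<^bsub>C\<^esub> inv\<^bsub>hom_group C (Dom C g) (Cod C g)\<^esub> g"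

context
  fixes C :: "('o, 'a) mon_cat" (structure)
begin

definition inverse_arrows :: "'a \<Rightarrow> 'a \<Rightarrow> bool" where
  "inverse_arrows f g \<longleftrightarrow> f \<in> Arr C \<and> g \<in> Hom C (Cod C f) (Dom C f) \<and>
     g \<cdot> f = ident C (Dom C f) \<and> f \<cdot> g = ident C (Cod C f)"

definition iso_arrow :: "'a \<Rightarrow> bool" where
  "iso_arrow f \<longleftrightarrow> (\<exists>g. inverse_arrows f g)"

definition inv_arrow :: "'a \<Rightarrow> 'a" where
  "inv_arrow f = (THE g. inverse_arrows f g)"

definition mono_arrow :: "'a \<Rightarrow> bool" where
  "mono_arrow f \<longleftrightarrow> f \<in> Arr C \<and>
     (\<forall>X \<in> Obj C. \<forall>g \<in> Hom C X (Dom C f). \<forall>h \<in> Hom C X (Dom C f). f \<cdot> g = f \<cdot> h \<longrightarrow> g = h)"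

definition epi_arrow :: "'a \<Rightarrow> bool" where
  "epi_arrow f \<longleftrightarrow> f \<in> Arr C \<and>
     (\<forall>X \<in> Obj C. \<forall>g \<in> Hom C (Cod C f) X. \<forall>h \<in> Hom C (Cod C f) X. g \<cdot> f = h \<cdot> f \<longrightarrow> g = h)"

definition zero_object :: "'o \<Rightarrow> bool" where
  "zero_object Z \<longleftrightarrow> Z \<in> Obj C \<and>
     (\<forall>X \<in> Obj C. (\<exists>!f. f \<in> Hom C X Z) \<and> (\<exists>!f. f \<in> Hom C Z X))"

definition is_kernel :: "'a \<Rightarrow> 'a \<Rightarrow> bool" where
  "is_kernel k f \<longleftrightarrow> f \<in> Arr C \<and> k \<in> Arr C \<and> Cod C k = Dom C f \<and>
     f \<cdot> k = Zero C (Dom C k) (Cod C f) \<and>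
     (\<forall>X \<in> Obj C. \<forall>h \<in> Hom C X (Dom C f). f \<cdot> h = Zero C X (Cod C f) \<longrightarrow>
        (\<exists>!h'. h' \<in> Hom C X (Dom C k) \<and> k \<cdot> h' = h))"

definition is_cokernel :: "'a \<Rightarrow> 'a \<Rightarrow> bool" where
  "is_cokernel q f \<longleftrightarrow> f \<in> Arr C \<and> q \<in> Arr C \<and> Dom C q = Cod C f \<and>
     q \<cdot> f = Zero C (Dom C f) (Cod C q) \<and>
     (\<forall>X \<in> Obj C. \<forall>h \<in> Hom C (Cod C f) X. h \<cdot> f = Zero C (Dom C f) X \<longrightarrow>
        (\<exists>!h'. h' \<in> Hom C (Cod C q) X \<and> h' \<cdot> q = h))"

end

record ('o, 'a) sum_diagram =
  sum_obj :: 'o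
  inj1 :: 'a
  inj2 :: 'a
  proj1 :: 'a
  proj2 :: 'a

context
  fixes C :: "('o, 'a) mon_cat" (structure)
begin

definition is_biproduct :: "'o \<Rightarrow> 'o \<Rightarrow> ('o, 'a) sum_diagram \<Rightarrow> bool" where
  "is_biproduct X Y S \<longleftrightarrow> sum_obj S \<in> Obj C \<and>
     inj1 S \<in> Hom C X (sum_obj S) \<and> inj2 S \<in> Hom C Y (sum_obj S) \<and>
     proj1 S \<in> Hom C (sum_obj S) X \<and> proj2 S \<in> Hom C (sum_obj S) Y \<and>
     proj1 S \<cdot> inj1 S = ident C X \<and> proj2 S \<cdot> inj2 S = ident C Y \<and>
     proj1 S \<cdot> inj2 S = Zero C Y X \<and> proj2 S \<cdot> inj1 S = Zero C X Y \<and>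
     inj1 S \<cdot> proj1 S \<oplus> inj2 S \<cdot> proj2 S = ident C (sum_obj S)"

end

locale category =
  fixes C :: "('o, 'a) mon_cat" (structure)
  assumes dom_closed: "f \<in> Arr C \<Longrightarrow> Dom C f \<in> Obj C"
    and cod_closed: "f \<in> Arr C \<Longrightarrow> Cod C f \<in> Obj C"
    and ident_closed: "X \<in> Obj C \<Longrightarrow> ident C X \<in> Hom C X X"
    and comp_closed: "f \<in> Hom C X Y \<Longrightarrow> g \<in> Hom C Y Z \<Longrightarrow> g \<cdot> f \<in> Hom C X Z"
    and ident_comp: "f \<in> Hom C X Y \<Longrightarrow> ident C Y \<cdot> f = f"
    and comp_ident: "f \<in> Hom C X Y \<Longrightarrow> f \<cdot> ident C X = f"
    and comp_assoc: "f \<in> Hom C X Y \<Longrightarrow> g \<in> Hom C Y Z \<Longrightarrow> h \<in> Hom C Z W \<Longrightarrow>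
      (h \<cdot> g) \<cdot> f = h \<cdot> (g \<cdot> f)"

locale abelian_category = category +
  assumes hom_comm_group: "X \<in> Obj C \<Longrightarrow> Y \<in> Obj C \<Longrightarrow> comm_group (hom_group C X Y)"
    and comp_add_left: "f \<in> Hom C X Y \<Longrightarrow> g \<in> Hom C Y Z \<Longrightarrow> h \<in> Hom C Y Z \<Longrightarrow>
      (g \<oplus> h) \<cdot> f = g \<cdot> f \<oplus> h \<cdot> f"
    and comp_add_right: "f \<in> Hom C X Y \<Longrightarrow> g \<in> Hom C X Y \<Longrightarrow> h \<in> Hom C Y Z \<Longrightarrow>
      h \<cdot> (f \<oplus> g) = h \<cdot> f \<oplus> h \<cdot> g"
    and ex_zero_object: "\<exists>Z. zero_object C Z"
    and ex_biproduct: "X \<in> Obj C \<Longrightarrow> Y \<in> Obj C \<Longrightarrow> \<exists>S. is_biproduct C X Y S"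
    and ex_kernel: "f \<in> Arr C \<Longrightarrow> \<exists>k. is_kernel C k f"
    and ex_cokernel: "f \<in> Arr C \<Longrightarrow> \<exists>q. is_cokernel C q f"
    and mono_is_kernel: "mono_arrow C k \<Longrightarrow> \<exists>f. is_kernel C k f"
    and epi_is_cokernel: "epi_arrow C q \<Longrightarrow> \<exists>f. is_cokernel C q f"

locale monoidal_category = category +
  assumes unit_closed: "\<I> \<in> Obj C"
    and tensor_obj_closed: "X \<in> Obj C \<Longrightarrow> Y \<in> Obj C \<Longrightarrow> X \<odot> Y \<in> Obj C"
    and tensor_closed: "f \<in> Hom C X X' \<Longrightarrow> g \<in> Hom C Y Y' \<Longrightarrow> f \<boxtimes> g \<in> Hom C (X \<odot> Y) (X' \<odot> Y')"
    and tensor_ident: "X \<in> Obj C \<Longrightarrow> Y \<in> Obj C \<Longrightarrow> ident C X \<boxtimes> ident C Y = ident C (X \<odot> Y)"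
    and tensor_comp: "f \<in> Hom C X X' \<Longrightarrow> f' \<in> Hom C X' X'' \<Longrightarrow>
      g \<in> Hom C Y Y' \<Longrightarrow> g' \<in> Hom C Y' Y'' \<Longrightarrow> (f' \<cdot> f) \<boxtimes> (g' \<cdot> g) = (f' \<boxtimes> g') \<cdot> (f \<boxtimes> g)"
    and assoc_closed: "X \<in> Obj C \<Longrightarrow> Y \<in> Obj C \<Longrightarrow> Z \<in> Obj C \<Longrightarrow>
      assoc C X Y Z \<in> Hom C ((X \<odot> Y) \<odot> Z) (X \<odot> (Y \<odot> Z))"
    and assoc_iso: "X \<in> Obj C \<Longrightarrow> Y \<in> Obj C \<Longrightarrow> Z \<in> Obj C \<Longrightarrow> iso_arrow C (assoc C X Y Z)"
    and assoc_natural: "f \<in> Hom C X X' \<Longrightarrow> g \<in> Hom C Y Y' \<Longrightarrow> h \<in> Hom C Z Z' \<Longrightarrow>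
      assoc C X' Y' Z' \<cdot> ((f \<boxtimes> g) \<boxtimes> h) = (f \<boxtimes> (g \<boxtimes> h)) \<cdot> assoc C X Y Z"
    and lunit_closed: "X \<in> Obj C \<Longrightarrow> lunit C X \<in> Hom C (\<I> \<odot> X) X"
    and lunit_iso: "X \<in> Obj C \<Longrightarrow> iso_arrow C (lunit C X)"
    and lunit_natural: "f \<in> Hom C X Y \<Longrightarrow> lunit C Y \<cdot> (ident C \<I> \<boxtimes> f) = f \<cdot> lunit C X"
    and runit_closed: "X \<in> Obj C \<Longrightarrow> runit C X \<in> Hom C (X \<odot> \<I>) X"
    and runit_iso: "X \<in> Obj C \<Longrightarrow> iso_arrow C (runit C X)"
    and runit_natural: "f \<in> Hom C X Y \<Longrightarrow> runit C Y \<cdot> (f \<boxtimes> ident C \<I>) = f \<cdot> runit C X"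
    and pentagon: "W \<in> Obj C \<Longrightarrow> X \<in> Obj C \<Longrightarrow> Y \<in> Obj C \<Longrightarrow> Z \<in> Obj C \<Longrightarrow>
      (ident C W \<boxtimes> assoc C X Y Z) \<cdot> (assoc C W (X \<odot> Y) Z \<cdot> (assoc C W X Y \<boxtimes> ident C Z)) =
      assoc C W X (Y \<odot> Z) \<cdot> assoc C (W \<odot> X) Y Z"
    and triangle: "X \<in> Obj C \<Longrightarrow> Y \<in> Obj C \<Longrightarrow>
      (ident C X \<boxtimes> lunit C Y) \<cdot> assoc C X \<I> Y = runit C X \<boxtimes> ident C Y"

text \<open>
  The tensor product of an abelian monoidal category is additive in each variable. This cannot be
  dropped: for \<open>\<odot>\<close> the direct sum, the condition \<open>m\<^sub>E (i \<otimes> i) = 0\<close> below forces the kernel to be zero.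
\<close>

locale abelian_monoidal_category = abelian_category + monoidal_category +
  assumes tensor_add_left: "f \<in> Hom C X X' \<Longrightarrow> g \<in> Hom C X X' \<Longrightarrow> h \<in> Hom C Y Y' \<Longrightarrow>
      (f \<oplus> g) \<boxtimes> h = (f \<boxtimes> h) \<oplus> (g \<boxtimes> h)"
    and tensor_add_right: "h \<in> Hom C Y Y' \<Longrightarrow> f \<in> Hom C X X' \<Longrightarrow> g \<in> Hom C X X' \<Longrightarrow>
      h \<boxtimes> (f \<oplus> g) = (h \<boxtimes> f) \<oplus> (h \<boxtimes> g)"


section \<open>Algebras and bimodules\<close>

record ('o, 'a) algebra_data =
  alg_obj :: 'o
  alg_mult :: 'a
  alg_unit :: 'a

record ('o, 'a) bimodule_data =
  bim_obj :: 'o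
  left_act :: 'a
  right_act :: 'a

context
  fixes C :: "('o, 'a) mon_cat" (structure)
begin

definition is_algebra :: "('o, 'a, 'z) algebra_data_scheme \<Rightarrow> bool" where
  "is_algebra A \<longleftrightarrow> (let a = alg_obj A; m = alg_mult A; u = alg_unit A; \<iota> = ident C a in
     a \<in> Obj C \<and> m \<in> Hom C (a \<odot> a) a \<and> u \<in> Hom C \<I> a \<and>
     m \<cdot> (m \<boxtimes> \<iota>) = m \<cdot> (\<iota> \<boxtimes> m) \<cdot> assoc C a a a \<and>
     m \<cdot> (u \<boxtimes> \<iota>) = lunit C a \<and>
     m \<cdot> (\<iota> \<boxtimes> u) = runit C a)"

definition algebra_hom ::
  "('o, 'a, 'y) algebra_data_scheme \<Rightarrow> ('o, 'a, 'z) algebra_data_scheme \<Rightarrow> 'a \<Rightarrow> bool" where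
  "algebra_hom A B f \<longleftrightarrow> f \<in> Hom C (alg_obj A) (alg_obj B) \<and>
     f \<cdot> alg_mult A = alg_mult B \<cdot> (f \<boxtimes> f) \<and> f \<cdot> alg_unit A = alg_unit B"

definition is_bimodule :: "('o, 'a) algebra_data \<Rightarrow> ('o, 'a) bimodule_data \<Rightarrow> bool" where
  "is_bimodule A M \<longleftrightarrow> (let a = alg_obj A; m = alg_mult A; u = alg_unit A; \<iota> = ident C a;
       x = bim_obj M; l = left_act M; r = right_act M; \<xi> = ident C x in
     x \<in> Obj C \<and> l \<in> Hom C (a \<odot> x) x \<and> r \<in> Hom C (x \<odot> a) x \<and>
     l \<cdot> (m \<boxtimes> \<xi>) = l \<cdot> (\<iota> \<boxtimes> l) \<cdot> assoc C a a x \<and>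
     l \<cdot> (u \<boxtimes> \<xi>) = lunit C x \<and>
     r \<cdot> (r \<boxtimes> \<iota>) = r \<cdot> (\<xi> \<boxtimes> m) \<cdot> assoc C x a a \<and>
     r \<cdot> (\<xi> \<boxtimes> u) = runit C x \<and>
     r \<cdot> (l \<boxtimes> \<iota>) = l \<cdot> (\<iota> \<boxtimes> r) \<cdot> assoc C a x a)"


section \<open>Second Hochschild cohomology\<close>

definition hoch_b1 :: "('o, 'a) algebra_data \<Rightarrow> ('o, 'a) bimodule_data \<Rightarrow> 'a \<Rightarrow> 'a" where
  "hoch_b1 A M f =
     left_act M \<cdot> (ident C (alg_obj A) \<boxtimes> f)
     \<ominus> f \<cdot> alg_mult A
     \<oplus> right_act M \<cdot> (f \<boxtimes> ident C (alg_obj A))"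

text \<open>The source of the values of \<open>hoch_b2\<close> is bracketed as \<open>(A \<odot> A) \<odot> A\<close>.\<close>

definition hoch_b2 :: "('o, 'a) algebra_data \<Rightarrow> ('o, 'a) bimodule_data \<Rightarrow> 'a \<Rightarrow> 'a" where
  "hoch_b2 A M f = (let a = alg_obj A; \<iota> = ident C a in
     left_act M \<cdot> (\<iota> \<boxtimes> f) \<cdot> assoc C a a a
     \<ominus> f \<cdot> (alg_mult A \<boxtimes> \<iota>)
     \<oplus> f \<cdot> (\<iota> \<boxtimes> alg_mult A) \<cdot> assoc C a a a
     \<ominus> right_act M \<cdot> (f \<boxtimes> \<iota>))"

definition hoch_Z2 :: "('o, 'a) algebra_data \<Rightarrow> ('o, 'a) bimodule_data \<Rightarrow> 'a set" where
  "hoch_Z2 A M = (let a = alg_obj A; x = bim_obj M in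
     kernel (hom_group C (a \<odot> a) x) (hom_group C (a \<odot> a \<odot> a) x) (hoch_b2 A M))"

definition hoch_B2 :: "('o, 'a) algebra_data \<Rightarrow> ('o, 'a) bimodule_data \<Rightarrow> 'a set" where
  "hoch_B2 A M = hoch_b1 A M ` Hom C (alg_obj A) (bim_obj M)"

definition hoch_Z2_group :: "('o, 'a) algebra_data \<Rightarrow> ('o, 'a) bimodule_data \<Rightarrow> 'a monoid" where
  "hoch_Z2_group A M =
     (hom_group C (alg_obj A \<odot> alg_obj A) (bim_obj M))\<lparr>carrier := hoch_Z2 A M\<rparr>"

definition hoch_H2 :: "('o, 'a) algebra_data \<Rightarrow> ('o, 'a) bimodule_data \<Rightarrow> 'a set monoid" where
  "hoch_H2 A M = hoch_Z2_group A M Mod hoch_B2 A M"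

definition hoch_class :: "('o, 'a) algebra_data \<Rightarrow> ('o, 'a) bimodule_data \<Rightarrow> 'a \<Rightarrow> 'a set" where
  "hoch_class A M \<omega> = hoch_B2 A M #>\<^bsub>hoch_Z2_group A M\<^esub> \<omega>"

end


section \<open>Hochschild extensions\<close>

record ('o, 'a) extension_data = "('o, 'a) algebra_data" +
  ext_proj :: 'a
  ext_incl :: 'a

context
  fixes C :: "('o, 'a) mon_cat" (structure)
begin

definition hochschild_extension ::
  "('o, 'a) algebra_data \<Rightarrow> ('o, 'a) bimodule_data \<Rightarrow> ('o, 'a) extension_data \<Rightarrow> bool" where
  "hochschild_extension A M E \<longleftrightarrow> (let m\<^sub>E = alg_mult E; \<pi> = ext_proj E; i = ext_incl E in
     is_algebra C E \<and> algebra_hom C E A \<pi> \<and>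
     i \<in> Hom C (bim_obj M) (alg_obj E) \<and> is_kernel C i \<pi> \<and>
     m\<^sub>E \<cdot> (i \<boxtimes> i) = Zero C (bim_obj M \<odot> bim_obj M) (alg_obj E) \<and>
     (\<exists>\<sigma> \<in> Hom C (alg_obj A) (alg_obj E).
        \<pi> \<cdot> \<sigma> = ident C (alg_obj A) \<and>
        i \<cdot> left_act M = m\<^sub>E \<cdot> (\<sigma> \<boxtimes> i) \<and>
        i \<cdot> right_act M = m\<^sub>E \<cdot> (i \<boxtimes> \<sigma>)))"

text \<open>
  The kernels of both projections are identified with \<open>M\<close> through the inclusions, and the morphism
  induced on kernels must respect this identification, i.e. it is the identity of \<open>M\<close>. If it were
  allowed to be any automorphism of \<open>M\<close>, the diagonal morphism \<open>(id, -id)\<close> would make the extensions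
  of \<open>\<omega>\<close> and of \<open>-\<omega>\<close> equivalent for every 2-cocycle \<open>\<omega>\<close>, even if \<open>2\<omega>\<close> is not a coboundary.
\<close>

definition extension_equiv ::
  "('o, 'a) algebra_data \<Rightarrow> ('o, 'a) bimodule_data \<Rightarrow>
   (('o, 'a) extension_data \<times> ('o, 'a) extension_data) set" where
  "extension_equiv A M = {(E, E').
     hochschild_extension A M E \<and> hochschild_extension A M E' \<and>
     (\<exists>f. algebra_hom C E E' f \<and> ext_proj E' \<cdot> f = ext_proj E \<and> f \<cdot> ext_incl E = ext_incl E')}"

definition Ext_set ::
  "('o, 'a) algebra_data \<Rightarrow> ('o, 'a) bimodule_data \<Rightarrow> ('o, 'a) extension_data set set" where
  "Ext_set A M = {E. hochschild_extension A M E} // extension_equiv A M"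

definition Ext_class ::
  "('o, 'a) algebra_data \<Rightarrow> ('o, 'a) bimodule_data \<Rightarrow> ('o, 'a) extension_data \<Rightarrow>
   ('o, 'a) extension_data set" where
  "Ext_class A M E = extension_equiv A M `` {E}"

definition cocycle_extension ::
  "('o, 'a) algebra_data \<Rightarrow> ('o, 'a) bimodule_data \<Rightarrow> ('o, 'a) sum_diagram \<Rightarrow> 'a \<Rightarrow>
   ('o, 'a) extension_data" where
  "cocycle_extension A M S \<omega> =
     (let i\<^sub>A = inj1 S; i\<^sub>M = inj2 S; p\<^sub>A = proj1 S; p\<^sub>M = proj2 S; u = alg_unit A in
      \<lparr>alg_obj = sum_obj S,
       alg_mult = i\<^sub>A \<cdot> alg_mult A \<cdot> (p\<^sub>A \<boxtimes> p\<^sub>A) \<oplus>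
         i\<^sub>M \<cdot> (right_act M \<cdot> (p\<^sub>M \<boxtimes> p\<^sub>A) \<oplus> left_act M \<cdot> (p\<^sub>A \<boxtimes> p\<^sub>M) \<ominus> \<omega> \<cdot> (p\<^sub>A \<boxtimes> p\<^sub>A)),
       alg_unit = i\<^sub>A \<cdot> u \<oplus> i\<^sub>M \<cdot> \<omega> \<cdot> (u \<boxtimes> u) \<cdot> inv_arrow C (lunit C \<I>),
       ext_proj = p\<^sub>A,
       ext_incl = i\<^sub>M\<rparr>)"

end

end

theory Submission
  imports Defs
begin

text \<open>
  A section \<open>\<sigma>\<close> of an extension \<open>E\<close> fails to be multiplicative by a morphism
  \<open>\<sigma> m - m\<^sub>E (\<sigma> \<otimes> \<sigma>) = i \<omega>\<close>, and associativity of \<open>E\<close> says that \<open>\<omega>\<close> is a 2-cocycle. The morphism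
  \<open>\<sigma> p\<^sub>A + i p\<^sub>M\<close> is then an equivalence from \<open>E\<^sub>\<omega>\<close> to \<open>E\<close>, which gives surjectivity. Equivalences carry
  sections to sections with the same cocycle, and the sections of \<open>E\<^sub>\<omega>\<close> are the \<open>i\<^sub>A + i\<^sub>M g\<close>, whose
  cocycles are the \<open>\<omega> - b\<^sup>1(g)\<close>. Hence \<open>E\<^sub>\<omega>\<close> and \<open>E\<^sub>\<omega>\<^sub>'\<close> are equivalent if and only if \<open>\<omega>\<close> and \<open>\<omega>'\<close>
  are cohomologous.
\<close>

text \<open>Cocycles are not normalised, and this shapes everything concerning units. The pair (1,0)
  is in general not a unit of \<open>E \<omega>\<close>. The correction \<omega>(1,1) works because
  the cocycle identity at (1,1,f) and (f,1,1) collapses to \<omega>(1,1)f = \<omega>(1,f) and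
  f\<omega>(1,1) = \<omega>(f,1), which cancels the -\<omega> of the multiplication. Conversely, in
  an arbitrary extension the equation 11 = 1 forces the unit to be \<sigma>(1) + i\<omega>(1,1), so
  that the comparison morphism preserves units. As the category is not strict, these computations
  also have to reconcile the left and right constraints of the unit object.

  An equivalence is only asked to be an algebra morphism over A that is the identity on M. Its
  invertibility, hence the symmetry of the relation, is a short five lemma, made explicit by means
  of a section.

  All kernel-valued morphisms (the cocycle of a section, the difference of two sections, the
  correction of the unit, the inverse of an equivalence) have one source: two morphisms into E with
  the same composite with \<pi> differ by a morphism through i.\<close>

lemma Hom_iff: "f \<in> Hom C X Y \<longleftrightarrow> f \<in> Arr C \<and> Dom C f = X \<and> Cod C f = Y"
  by (auto simp: Hom_def)

section \<open>Composition and isomorphisms\<close>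

text \<open>
  The axioms are restated with \<open>Dom\<close> and \<open>Cod\<close> side conditions in place of \<open>Hom\<close> memberships, whose
  intermediate objects the simplifier cannot guess.
\<close>

context category
begin

declare dom_closed [simp] cod_closed [simp]

lemma comp_arr [simp]:
  assumes "f \<in> Arr C" "g \<in> Arr C" "Dom C g = Cod C f"
  shows "g \<cdot> f \<in> Arr C" "Dom C (g \<cdot> f) = Dom C f" "Cod C (g \<cdot> f) = Cod C g"
  using comp_closed[of f "Dom C f" "Cod C f" g "Cod C g"] assms by (auto simp: Hom_iff)

lemma ident_arr [simp]:
  assumes "X \<in> Obj C"
  shows "ident C X \<in> Arr C" "Dom C (ident C X) = X" "Cod C (ident C X) = X"
  using ident_closed[OF assms] by (auto simp: Hom_iff)

lemma ident_comp_arr [simp]: "f \<in> Arr C \<Longrightarrow> Cod C f = X \<Longrightarrow> ident C X \<cdot> f = f"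
  by (rule ident_comp) (auto simp: Hom_iff)

lemma comp_ident_arr [simp]: "f \<in> Arr C \<Longrightarrow> Dom C f = X \<Longrightarrow> f \<cdot> ident C X = f"
  by (rule comp_ident) (auto simp: Hom_iff)

lemma comp_assoc_arr [simp]:
  "f \<in> Arr C \<Longrightarrow> g \<in> Arr C \<Longrightarrow> h \<in> Arr C \<Longrightarrow> Dom C g = Cod C f \<Longrightarrow> Dom C h = Cod C g \<Longrightarrow>
    (h \<cdot> g) \<cdot> f = h \<cdot> (g \<cdot> f)"
  by (rule comp_assoc) (auto simp: Hom_iff)

text \<open>Two-sided inverses are unique, by h = h(fg) = (hf)g = g, so the definite description
  behind \<open>inv_arrow\<close> denotes one.\<close>

lemma inverse_arrows_inv_arrow:
  assumes "iso_arrow C f"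
  shows "inverse_arrows C f (inv_arrow C f)"
proof -
  obtain g where g: "inverse_arrows C f g"
    using assms by (auto simp: iso_arrow_def)
  have "h = g" if h: "inverse_arrows C f h" for h
  proof -
    have "h = h \<cdot> (f \<cdot> g)"
      using g h by (simp add: inverse_arrows_def Hom_iff)
    also have "\<dots> = (h \<cdot> f) \<cdot> g"
      using g h by (subst comp_assoc_arr) (simp_all add: inverse_arrows_def Hom_iff)
    also have "\<dots> = g"
      using g h by (simp add: inverse_arrows_def Hom_iff)
    finally show ?thesis .
  qed
  then show ?thesis
    unfolding inv_arrow_def using g by (rule theI[rotated])
qed

lemma inv_arrow_arr [simp]:
  assumes "iso_arrow C f"
  shows "inv_arrow C f \<in> Arr C" "Dom C (inv_arrow C f) = Cod C f" "Cod C (inv_arrow C f) = Dom C f"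
    "inv_arrow C f \<cdot> f = ident C (Dom C f)" "f \<cdot> inv_arrow C f = ident C (Cod C f)"
  using inverse_arrows_inv_arrow[OF assms] by (auto simp: inverse_arrows_def Hom_iff)

lemma iso_cancel_right:
  assumes "iso_arrow C k" "f \<in> Arr C" "g \<in> Arr C" "Dom C f = Cod C k" "Dom C g = Cod C k"
    and eq: "f \<cdot> k = g \<cdot> k"
  shows "f = g"
proof -
  have k: "k \<in> Arr C"
    using assms(1) by (auto simp: iso_arrow_def inverse_arrows_def)
  have "f \<cdot> k \<cdot> inv_arrow C k = g \<cdot> k \<cdot> inv_arrow C k"
    by (simp only: eq)
  then show ?thesis
    using assms(1-5) k by simp
qed

lemma iso_cancel_left:
  assumes "iso_arrow C k" "f \<in> Arr C" "g \<in> Arr C" "Cod C f = Dom C k" "Cod C g = Dom C k"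
    and eq: "k \<cdot> f = k \<cdot> g"
  shows "f = g"
proof -
  have k: "k \<in> Arr C"
    using assms(1) by (auto simp: iso_arrow_def inverse_arrows_def)
  have "inv_arrow C k \<cdot> k \<cdot> f = inv_arrow C k \<cdot> k \<cdot> g"
    using assms k by (simp add: eq del: inv_arrow_arr(4,5))
  then show ?thesis
    using assms k by (simp del: comp_assoc_arr)
qed

end

section \<open>Additive calculus on morphisms\<close>

context abelian_category
begin

text \<open>Reading the hom-group off the arrow makes negation a unary operation. With
  \<open>Diff_eq\<close>, differences become sums, which \<open>add_ac_arr\<close> can
  normalise.\<close>

definition neg :: "'b \<Rightarrow> 'b" where
  "neg f = inv\<^bsub>hom_group C (Dom C f) (Cod C f)\<^esub> f"

lemma Diff_eq: "f \<ominus> g = f \<oplus> neg g"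
  by (simp add: Diff_def neg_def)

lemma hom_group_simps [simp]:
  "carrier (hom_group C X Y) = Hom C X Y"
  "mult (hom_group C X Y) = Add C"
  "one (hom_group C X Y) = Zero C X Y"
  by (simp_all add: hom_group_def)

lemma zero_arr [simp]:
  assumes "X \<in> Obj C" "Y \<in> Obj C"
  shows "Zero C X Y \<in> Arr C" "Dom C (Zero C X Y) = X" "Cod C (Zero C X Y) = Y"
proof -
  interpret G: comm_group "hom_group C X Y" using assms by (rule hom_comm_group)
  show "Zero C X Y \<in> Arr C" "Dom C (Zero C X Y) = X" "Cod C (Zero C X Y) = Y"
    using G.one_closed by (auto simp: Hom_iff)
qed

lemma add_arr [simp]:
  assumes "f \<in> Arr C" "g \<in> Arr C" "Dom C f = Dom C g" "Cod C f = Cod C g"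
  shows "f \<oplus> g \<in> Arr C" "Dom C (f \<oplus> g) = Dom C g" "Cod C (f \<oplus> g) = Cod C g"
proof -
  interpret G: comm_group "hom_group C (Dom C g) (Cod C g)"
    using assms dom_closed cod_closed by (intro hom_comm_group) auto
  show "f \<oplus> g \<in> Arr C" "Dom C (f \<oplus> g) = Dom C g" "Cod C (f \<oplus> g) = Cod C g"
    using G.m_closed[of f g] assms by (auto simp: Hom_iff)
qed

lemma neg_arr [simp]:
  assumes "f \<in> Arr C"
  shows "neg f \<in> Arr C" "Dom C (neg f) = Dom C f" "Cod C (neg f) = Cod C f"
proof -
  interpret G: comm_group "hom_group C (Dom C f) (Cod C f)"
    using assms dom_closed cod_closed by (intro hom_comm_group) auto
  show "neg f \<in> Arr C" "Dom C (neg f) = Dom C f" "Cod C (neg f) = Cod C f"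
    using G.inv_closed[of f] assms by (auto simp: Hom_iff neg_def)
qed

lemma zero_add [simp]:
  assumes "f \<in> Arr C" "Dom C f = X" "Cod C f = Y"
  shows "Zero C X Y \<oplus> f = f" "f \<oplus> Zero C X Y = f"
proof -
  interpret G: comm_group "hom_group C X Y"
    using assms dom_closed cod_closed by (intro hom_comm_group) auto
  show "Zero C X Y \<oplus> f = f" "f \<oplus> Zero C X Y = f"
    using G.l_one[of f] G.r_one[of f] assms by (auto simp: Hom_iff)
qed

lemma add_neg [simp]:
  assumes "f \<in> Arr C"
  shows "f \<oplus> neg f = Zero C (Dom C f) (Cod C f)" "neg f \<oplus> f = Zero C (Dom C f) (Cod C f)"
proof -
  interpret G: comm_group "hom_group C (Dom C f) (Cod C f)"
    using assms dom_closed cod_closed by (intro hom_comm_group) auto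
  show "f \<oplus> neg f = Zero C (Dom C f) (Cod C f)" "neg f \<oplus> f = Zero C (Dom C f) (Cod C f)"
    using G.r_inv[of f] G.l_inv[of f] assms by (auto simp: Hom_iff neg_def)
qed

lemma add_assoc_arr:
  assumes "f \<in> Arr C" "g \<in> Arr C" "h \<in> Arr C" "Dom C f = Dom C g" "Cod C f = Cod C g"
    "Dom C g = Dom C h" "Cod C g = Cod C h"
  shows "f \<oplus> g \<oplus> h = f \<oplus> (g \<oplus> h)"
proof -
  interpret G: comm_group "hom_group C (Dom C h) (Cod C h)"
    using assms dom_closed cod_closed by (intro hom_comm_group) auto
  show ?thesis
    using G.m_assoc[of f g h] assms by (auto simp: Hom_iff)
qed

lemma add_commute_arr:
  assumes "f \<in> Arr C" "g \<in> Arr C" "Dom C f = Dom C g" "Cod C f = Cod C g"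
  shows "f \<oplus> g = g \<oplus> f"
proof -
  interpret G: comm_group "hom_group C (Dom C g) (Cod C g)"
    using assms dom_closed cod_closed by (intro hom_comm_group) auto
  show ?thesis
    using G.m_comm[of f g] assms by (auto simp: Hom_iff)
qed

lemma add_left_commute_arr:
  assumes "f \<in> Arr C" "g \<in> Arr C" "h \<in> Arr C" "Dom C f = Dom C g" "Cod C f = Cod C g"
    "Dom C g = Dom C h" "Cod C g = Cod C h"
  shows "f \<oplus> (g \<oplus> h) = g \<oplus> (f \<oplus> h)"
  using assms add_commute_arr[of f g] by (simp add: add_assoc_arr[symmetric])

lemmas add_ac_arr = add_assoc_arr add_commute_arr add_left_commute_arr

lemma add_left_cancel_arr:
  assumes "f \<in> Arr C" "g \<in> Arr C" "h \<in> Arr C" "Dom C f = Dom C g" "Cod C f = Cod C g"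
    "Dom C h = Dom C g" "Cod C h = Cod C g"
  shows "h \<oplus> f = h \<oplus> g \<longleftrightarrow> f = g"
proof
  assume "h \<oplus> f = h \<oplus> g"
  then have "neg h \<oplus> h \<oplus> f = neg h \<oplus> h \<oplus> g"
    using assms by (simp add: add_assoc_arr del: add_neg)
  then show "f = g"
    using assms by simp
qed simp

lemma add_right_cancel_arr:
  assumes "f \<in> Arr C" "g \<in> Arr C" "h \<in> Arr C" "Dom C f = Dom C g" "Cod C f = Cod C g"
    "Dom C h = Dom C g" "Cod C h = Cod C g"
  shows "f \<oplus> h = g \<oplus> h \<longleftrightarrow> f = g"
  using add_left_cancel_arr[OF assms] add_commute_arr[of f h] add_commute_arr[of g h] assms by simp

lemma add_neg_cancel:
  assumes "f \<in> Arr C" "g \<in> Arr C" "Dom C f = Dom C g" "Cod C f = Cod C g"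
  shows "f \<oplus> neg g \<oplus> g = f" "f \<oplus> g \<oplus> neg g = f"
  using assms by (simp_all add: add_assoc_arr)

lemma eq_add_neg_iff:
  assumes "f \<in> Arr C" "g \<in> Arr C" "h \<in> Arr C" "Dom C f = Dom C g" "Cod C f = Cod C g"
    "Dom C h = Dom C g" "Cod C h = Cod C g"
  shows "f = g \<oplus> neg h \<longleftrightarrow> f \<oplus> h = g"
  using assms by (metis add_neg_cancel)

lemma comp_distrib_left:
  "f \<in> Arr C \<Longrightarrow> g \<in> Arr C \<Longrightarrow> h \<in> Arr C \<Longrightarrow> Dom C g = Cod C f \<Longrightarrow> Dom C h = Cod C f \<Longrightarrow>
    Cod C g = Cod C h \<Longrightarrow> (g \<oplus> h) \<cdot> f = g \<cdot> f \<oplus> h \<cdot> f"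
  by (rule comp_add_left) (auto simp: Hom_iff)

lemma comp_distrib_right:
  "f \<in> Arr C \<Longrightarrow> g \<in> Arr C \<Longrightarrow> h \<in> Arr C \<Longrightarrow> Dom C h = Cod C f \<Longrightarrow> Dom C h = Cod C g \<Longrightarrow>
    Dom C f = Dom C g \<Longrightarrow> h \<cdot> (f \<oplus> g) = h \<cdot> f \<oplus> h \<cdot> g"
  by (rule comp_add_right) (auto simp: Hom_iff)

text \<open>An additive operation sends zero to some z with z + z = z; this criterion then yields
  the zero laws for composition and for the tensor product.\<close>

lemma idem_add_eq_zero:
  assumes "f \<in> Arr C" "f \<oplus> f = f"
  shows "f = Zero C (Dom C f) (Cod C f)"
proof -
  have "f \<oplus> f = f \<oplus> Zero C (Dom C f) (Cod C f)"
    using assms by simp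
  then show ?thesis
    using assms add_left_cancel_arr[of f "Zero C (Dom C f) (Cod C f)" f]
    by (simp)
qed

lemma zero_comp [simp]:
  assumes "f \<in> Arr C" "Cod C f = Y" "Z \<in> Obj C"
  shows "Zero C Y Z \<cdot> f = Zero C (Dom C f) Z"
proof -
  have Y: "Y \<in> Obj C"
    using assms cod_closed by auto
  have "Zero C Y Z \<cdot> f \<oplus> Zero C Y Z \<cdot> f = (Zero C Y Z \<oplus> Zero C Y Z) \<cdot> f"
    using assms Y by (simp add: comp_distrib_left del: zero_add)
  then have "Zero C Y Z \<cdot> f \<oplus> Zero C Y Z \<cdot> f = Zero C Y Z \<cdot> f"
    using assms Y by simp
  from idem_add_eq_zero[OF _ this] show ?thesis
    using assms Y by simp
qed

lemma comp_zero [simp]: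
  assumes "f \<in> Arr C" "Dom C f = Y" "X \<in> Obj C"
  shows "f \<cdot> Zero C X Y = Zero C X (Cod C f)"
proof -
  have Y: "Y \<in> Obj C"
    using assms dom_closed by auto
  have "f \<cdot> Zero C X Y \<oplus> f \<cdot> Zero C X Y = f \<cdot> (Zero C X Y \<oplus> Zero C X Y)"
    using assms Y by (simp add: comp_distrib_right del: zero_add)
  then have "f \<cdot> Zero C X Y \<oplus> f \<cdot> Zero C X Y = f \<cdot> Zero C X Y"
    using assms Y by simp
  from idem_add_eq_zero[OF _ this] show ?thesis
    using assms Y by simp
qed

lemma neg_unique:
  assumes "f \<in> Arr C" "g \<in> Arr C" "Dom C f = Dom C g" "Cod C f = Cod C g"
    "f \<oplus> g = Zero C (Dom C g) (Cod C g)"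
  shows "f = neg g"
  using assms eq_add_neg_iff[of f "Zero C (Dom C g) (Cod C g)" g]
  by (simp)

lemma neg_zero [simp]:
  assumes "X \<in> Obj C" "Y \<in> Obj C"
  shows "neg (Zero C X Y) = Zero C X Y"
  using assms by (intro neg_unique[symmetric]) simp_all

lemma comp_neg_right [simp]:
  assumes "f \<in> Arr C" "g \<in> Arr C" "Dom C g = Cod C f"
  shows "g \<cdot> neg f = neg (g \<cdot> f)"
  using assms by (intro neg_unique) (simp_all flip: comp_distrib_right)

lemma comp_neg_left [simp]:
  assumes "f \<in> Arr C" "g \<in> Arr C" "Dom C g = Cod C f"
  shows "neg g \<cdot> f = neg (g \<cdot> f)"
  using assms by (intro neg_unique) (simp_all flip: comp_distrib_left)

lemma neg_add_distrib:
  assumes "f \<in> Arr C" "g \<in> Arr C" "Dom C f = Dom C g" "Cod C f = Cod C g"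
  shows "neg (f \<oplus> g) = neg f \<oplus> neg g"
proof (rule neg_unique[symmetric])
  have "neg f \<oplus> neg g \<oplus> (f \<oplus> g) = (neg f \<oplus> f) \<oplus> (neg g \<oplus> g)"
    using assms by (simp add: add_ac_arr del: add_neg zero_add)
  then show "neg f \<oplus> neg g \<oplus> (f \<oplus> g) = Zero C (Dom C (f \<oplus> g)) (Cod C (f \<oplus> g))"
    using assms by (simp)
qed (use assms in simp_all)

text \<open>The left side has the shape of \<open>hoch_b2\<close>. Moving the two negative terms
  across gives a cocycle identity without signs, which is the form used in
  \<open>Z2_iff\<close>.\<close>

lemma alternating_sum_eq_zero_iff:
  assumes "f \<in> Arr C" "g \<in> Arr C" "h \<in> Arr C" "k \<in> Arr C"
    "Dom C f = Dom C g" "Cod C f = Cod C g" "Dom C h = Dom C g" "Cod C h = Cod C g"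
    "Dom C k = Dom C g" "Cod C k = Cod C g"
  shows "f \<ominus> g \<oplus> h \<ominus> k = Zero C (Dom C g) (Cod C g) \<longleftrightarrow> f \<oplus> h = g \<oplus> k"
proof -
  let ?z = "Zero C (Dom C g) (Cod C g)"
  have 1: "f \<ominus> g \<oplus> h \<ominus> k = f \<oplus> h \<oplus> neg (g \<oplus> k)"
    using assms by (simp add: Diff_eq neg_add_distrib add_ac_arr)
  have 2: "?z = f \<oplus> h \<oplus> neg (g \<oplus> k) \<longleftrightarrow> ?z \<oplus> (g \<oplus> k) = f \<oplus> h"
    by (rule eq_add_neg_iff) (use assms in \<open>simp_all \<close>)
  have 3: "?z \<oplus> (g \<oplus> k) = g \<oplus> k"
    using assms by simp
  show ?thesis
    unfolding 1 using 2 3 by metis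
qed

end

section \<open>Tensor products and unit constraints\<close>

context monoidal_category
begin

declare unit_closed [simp] tensor_obj_closed [simp] assoc_iso [simp] lunit_iso [simp] runit_iso [simp]

lemma tensor_arr [simp]:
  assumes "f \<in> Arr C" "g \<in> Arr C"
  shows "f \<boxtimes> g \<in> Arr C" "Dom C (f \<boxtimes> g) = Dom C f \<odot> Dom C g" "Cod C (f \<boxtimes> g) = Cod C f \<odot> Cod C g"
  using tensor_closed[of f "Dom C f" "Cod C f" g "Dom C g" "Cod C g"] assms by (auto simp: Hom_iff)

lemma assoc_arr [simp]:
  assumes "X \<in> Obj C" "Y \<in> Obj C" "Z \<in> Obj C"
  shows "assoc C X Y Z \<in> Arr C" "Dom C (assoc C X Y Z) = X \<odot> Y \<odot> Z"
    "Cod C (assoc C X Y Z) = X \<odot> (Y \<odot> Z)"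
  using assoc_closed[OF assms] by (auto simp: Hom_iff)

lemma lunit_arr [simp]:
  assumes "X \<in> Obj C"
  shows "lunit C X \<in> Arr C" "Dom C (lunit C X) = \<I> \<odot> X" "Cod C (lunit C X) = X"
  using lunit_closed[OF assms] by (auto simp: Hom_iff)

lemma runit_arr [simp]:
  assumes "X \<in> Obj C"
  shows "runit C X \<in> Arr C" "Dom C (runit C X) = X \<odot> \<I>" "Cod C (runit C X) = X"
  using runit_closed[OF assms] by (auto simp: Hom_iff)

declare tensor_ident [simp]

lemma tensor_comp_arr [simp]:
  "f \<in> Arr C \<Longrightarrow> f' \<in> Arr C \<Longrightarrow> g \<in> Arr C \<Longrightarrow> g' \<in> Arr C \<Longrightarrow> Dom C f' = Cod C f \<Longrightarrow>
    Dom C g' = Cod C g \<Longrightarrow> (f' \<boxtimes> g') \<cdot> (f \<boxtimes> g) = (f' \<cdot> f) \<boxtimes> (g' \<cdot> g)"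
  by (rule tensor_comp[symmetric]) (auto simp: Hom_iff)

text \<open>Composites are normalised to the right, so the interchange law must also apply in front
  of a further factor \<open>t\<close>. The other lemmas with this suffix serve the same
  purpose.\<close>

lemma tensor_comp_tail [simp]:
  assumes "f \<in> Arr C" "f' \<in> Arr C" "g \<in> Arr C" "g' \<in> Arr C" "Dom C f' = Cod C f"
    "Dom C g' = Cod C g" "t \<in> Arr C" "Cod C t = Dom C f \<odot> Dom C g"
  shows "(f' \<boxtimes> g') \<cdot> ((f \<boxtimes> g) \<cdot> t) = ((f' \<cdot> f) \<boxtimes> (g' \<cdot> g)) \<cdot> t"
  using assms comp_assoc_arr[of t "f \<boxtimes> g" "f' \<boxtimes> g'"] by (simp del: comp_assoc_arr)

lemma assoc_natural_arr [simp]: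
  "f \<in> Arr C \<Longrightarrow> g \<in> Arr C \<Longrightarrow> h \<in> Arr C \<Longrightarrow> Cod C f = X \<Longrightarrow> Cod C g = Y \<Longrightarrow> Cod C h = Z \<Longrightarrow>
    assoc C X Y Z \<cdot> ((f \<boxtimes> g) \<boxtimes> h) = (f \<boxtimes> (g \<boxtimes> h)) \<cdot> assoc C (Dom C f) (Dom C g) (Dom C h)"
  by (rule assoc_natural) (auto simp: Hom_iff)

lemma lunit_natural_arr:
  "f \<in> Arr C \<Longrightarrow> lunit C (Cod C f) \<cdot> (ident C \<I> \<boxtimes> f) = f \<cdot> lunit C (Dom C f)"
  by (rule lunit_natural) (auto simp: Hom_iff)

lemma runit_natural_arr:
  "f \<in> Arr C \<Longrightarrow> runit C (Cod C f) \<cdot> (f \<boxtimes> ident C \<I>) = f \<cdot> runit C (Dom C f)"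
  by (rule runit_natural) (auto simp: Hom_iff)

text \<open>Naturality of the left constraint at the arrow \<open>lunit C X\<close> itself, followed
  by cancelling the isomorphism \<open>lunit C X\<close>.\<close>

lemma lunit_unit_tensor:
  assumes X: "X \<in> Obj C"
  shows "lunit C (\<I> \<odot> X) = ident C \<I> \<boxtimes> lunit C X"
  using X lunit_natural_arr[of "lunit C X"]
  by (intro iso_cancel_left[of "lunit C X" "lunit C (\<I> \<odot> X)"]) simp_all

lemma runit_tensor_unit:
  assumes X: "X \<in> Obj C"
  shows "runit C (X \<odot> \<I>) = runit C X \<boxtimes> ident C \<I>"
  using X runit_natural_arr[of "runit C X"]
  by (intro iso_cancel_left[of "runit C X" "runit C (X \<odot> \<I>)"]) simp_all

text \<open>
  Associativity and unit axioms are used in the form for generalised elements \<open>f : X' \<rightarrow> X\<close>, which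
  survives the merging of tensor products by the simplifier.
\<close>

lemma assoc_elements:
  assumes eq: "p \<cdot> (q \<boxtimes> ident C Z) = p' \<cdot> (ident C X \<boxtimes> q') \<cdot> assoc C X Y Z"
    and arr: "p \<in> Arr C" "q \<in> Arr C" "p' \<in> Arr C" "q' \<in> Arr C" "f \<in> Arr C" "g \<in> Arr C" "h \<in> Arr C"
    and cod: "Cod C f = X" "Cod C g = Y" "Cod C h = Z"
    and dom: "Dom C q = X \<odot> Y" "Dom C q' = Y \<odot> Z" "Dom C p = Cod C q \<odot> Z" "Dom C p' = X \<odot> Cod C q'"
  shows "p \<cdot> ((q \<cdot> (f \<boxtimes> g)) \<boxtimes> h) =
    p' \<cdot> ((f \<boxtimes> (q' \<cdot> (g \<boxtimes> h))) \<cdot> assoc C (Dom C f) (Dom C g) (Dom C h))"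
proof -
  have [simp]: "X \<in> Obj C" "Y \<in> Obj C" "Z \<in> Obj C"
    using arr cod by auto
  have "p \<cdot> (q \<boxtimes> ident C Z) \<cdot> ((f \<boxtimes> g) \<boxtimes> h)
      = p' \<cdot> (ident C X \<boxtimes> q') \<cdot> assoc C X Y Z \<cdot> ((f \<boxtimes> g) \<boxtimes> h)"
    by (simp only: eq)
  then show ?thesis
    using arr cod dom by simp
qed

lemma unit_left_elements:
  assumes eq: "p \<cdot> (v \<boxtimes> ident C X) = lunit C X"
    and arr: "p \<in> Arr C" "v \<in> Arr C" "Dom C v = \<I>" "Dom C p = Cod C v \<odot> X" "f \<in> Arr C" "Cod C f = X"
  shows "p \<cdot> (v \<boxtimes> f) = f \<cdot> lunit C (Dom C f)"
proof -
  have [simp]: "X \<in> Obj C"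
    using arr by auto
  have "p \<cdot> (v \<boxtimes> ident C X) \<cdot> (ident C \<I> \<boxtimes> f) = f \<cdot> lunit C (Dom C f)"
    using arr lunit_natural_arr[of f] by (simp only: eq)
  then show ?thesis
    using arr by simp
qed

lemma unit_right_elements:
  assumes eq: "p \<cdot> (ident C X \<boxtimes> v) = runit C X"
    and arr: "p \<in> Arr C" "v \<in> Arr C" "Dom C v = \<I>" "Dom C p = X \<odot> Cod C v" "f \<in> Arr C" "Cod C f = X"
  shows "p \<cdot> (f \<boxtimes> v) = f \<cdot> runit C (Dom C f)"
proof -
  have [simp]: "X \<in> Obj C"
    using arr by auto
  have "p \<cdot> (ident C X \<boxtimes> v) \<cdot> (f \<boxtimes> ident C \<I>) = f \<cdot> runit C (Dom C f)"
    using arr runit_natural_arr[of f] by (simp only: eq)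
  then show ?thesis
    using arr by simp
qed

end

section \<open>Bilinearity of the tensor product\<close>

context abelian_monoidal_category
begin

lemma tensor_distrib_left:
  "f \<in> Arr C \<Longrightarrow> g \<in> Arr C \<Longrightarrow> h \<in> Arr C \<Longrightarrow> Dom C f = Dom C g \<Longrightarrow> Cod C f = Cod C g \<Longrightarrow>
    (f \<oplus> g) \<boxtimes> h = (f \<boxtimes> h) \<oplus> (g \<boxtimes> h)"
  by (rule tensor_add_left) (auto simp: Hom_iff)

lemma tensor_distrib_right:
  "f \<in> Arr C \<Longrightarrow> g \<in> Arr C \<Longrightarrow> h \<in> Arr C \<Longrightarrow> Dom C f = Dom C g \<Longrightarrow> Cod C f = Cod C g \<Longrightarrow>
    h \<boxtimes> (f \<oplus> g) = (h \<boxtimes> f) \<oplus> (h \<boxtimes> g)"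
  by (rule tensor_add_right) (auto simp: Hom_iff)

lemmas distribs = comp_distrib_left comp_distrib_right tensor_distrib_left tensor_distrib_right

lemma zero_tensor [simp]:
  assumes "f \<in> Arr C" "X \<in> Obj C" "Y \<in> Obj C"
  shows "Zero C X Y \<boxtimes> f = Zero C (X \<odot> Dom C f) (Y \<odot> Cod C f)"
proof -
  have "Zero C X Y \<boxtimes> f \<oplus> Zero C X Y \<boxtimes> f = (Zero C X Y \<oplus> Zero C X Y) \<boxtimes> f"
    using assms by (simp add: tensor_distrib_left del: zero_add)
  then have "Zero C X Y \<boxtimes> f \<oplus> Zero C X Y \<boxtimes> f = Zero C X Y \<boxtimes> f"
    using assms by simp
  from idem_add_eq_zero[OF _ this] show ?thesis
    using assms by simp
qed

lemma tensor_zero [simp]: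
  assumes "f \<in> Arr C" "X \<in> Obj C" "Y \<in> Obj C"
  shows "f \<boxtimes> Zero C X Y = Zero C (Dom C f \<odot> X) (Cod C f \<odot> Y)"
proof -
  have "f \<boxtimes> Zero C X Y \<oplus> f \<boxtimes> Zero C X Y = f \<boxtimes> (Zero C X Y \<oplus> Zero C X Y)"
    using assms by (simp add: tensor_distrib_right del: zero_add)
  then have "f \<boxtimes> Zero C X Y \<oplus> f \<boxtimes> Zero C X Y = f \<boxtimes> Zero C X Y"
    using assms by simp
  from idem_add_eq_zero[OF _ this] show ?thesis
    using assms by simp
qed

lemma tensor_neg_left [simp]:
  assumes "f \<in> Arr C" "g \<in> Arr C"
  shows "neg f \<boxtimes> g = neg (f \<boxtimes> g)"
  using assms by (intro neg_unique) (simp_all flip: tensor_distrib_left)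

lemma tensor_neg_right [simp]:
  assumes "f \<in> Arr C" "g \<in> Arr C"
  shows "f \<boxtimes> neg g = neg (f \<boxtimes> g)"
  using assms by (intro neg_unique) (simp_all flip: tensor_distrib_right)

end

section \<open>The algebra, the bimodule and the cocycle identity\<close>

locale hochschild_setting = abelian_monoidal_category C
  for C :: "('o, 'a) mon_cat" (structure) +
  fixes A :: "('o, 'a) algebra_data" and M :: "('o, 'a) bimodule_data"
  assumes algebra: "is_algebra C A" and bimodule: "is_bimodule C A M"
begin

abbreviation a where "a \<equiv> alg_obj A"
abbreviation m where "m \<equiv> alg_mult A"
abbreviation u where "u \<equiv> alg_unit A"
abbreviation x where "x \<equiv> bim_obj M"
abbreviation l where "l \<equiv> left_act M"
abbreviation r where "r \<equiv> right_act M"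

lemma data_arr [simp]:
  "a \<in> Obj C" "m \<in> Arr C" "Dom C m = a \<odot> a" "Cod C m = a" "u \<in> Arr C" "Dom C u = \<I>" "Cod C u = a"
  "x \<in> Obj C" "l \<in> Arr C" "Dom C l = a \<odot> x" "Cod C l = x" "r \<in> Arr C" "Dom C r = x \<odot> a" "Cod C r = x"
  using algebra bimodule by (auto simp: is_algebra_def is_bimodule_def Let_def Hom_iff)

lemma mult_assoc:
  assumes "f \<in> Arr C" "g \<in> Arr C" "h \<in> Arr C" "Cod C f = a" "Cod C g = a" "Cod C h = a"
  shows "m \<cdot> ((m \<cdot> (f \<boxtimes> g)) \<boxtimes> h) =
    m \<cdot> ((f \<boxtimes> (m \<cdot> (g \<boxtimes> h))) \<cdot> assoc C (Dom C f) (Dom C g) (Dom C h))"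
  by (rule assoc_elements)
    (use algebra assms in \<open>simp_all add: is_algebra_def Let_def del: comp_assoc_arr\<close>)

lemma left_assoc:
  assumes "f \<in> Arr C" "g \<in> Arr C" "h \<in> Arr C" "Cod C f = a" "Cod C g = a" "Cod C h = x"
  shows "l \<cdot> ((m \<cdot> (f \<boxtimes> g)) \<boxtimes> h) =
    l \<cdot> ((f \<boxtimes> (l \<cdot> (g \<boxtimes> h))) \<cdot> assoc C (Dom C f) (Dom C g) (Dom C h))"
  by (rule assoc_elements)
    (use bimodule assms in \<open>simp_all add: is_bimodule_def Let_def del: comp_assoc_arr\<close>)

lemma right_assoc:
  assumes "f \<in> Arr C" "g \<in> Arr C" "h \<in> Arr C" "Cod C f = x" "Cod C g = a" "Cod C h = a"
  shows "r \<cdot> ((r \<cdot> (f \<boxtimes> g)) \<boxtimes> h) =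
    r \<cdot> ((f \<boxtimes> (m \<cdot> (g \<boxtimes> h))) \<cdot> assoc C (Dom C f) (Dom C g) (Dom C h))"
  by (rule assoc_elements)
    (use bimodule assms in \<open>simp_all add: is_bimodule_def Let_def del: comp_assoc_arr\<close>)

lemma middle_assoc:
  assumes "f \<in> Arr C" "g \<in> Arr C" "h \<in> Arr C" "Cod C f = a" "Cod C g = x" "Cod C h = a"
  shows "r \<cdot> ((l \<cdot> (f \<boxtimes> g)) \<boxtimes> h) =
    l \<cdot> ((f \<boxtimes> (r \<cdot> (g \<boxtimes> h))) \<cdot> assoc C (Dom C f) (Dom C g) (Dom C h))"
  by (rule assoc_elements)
    (use bimodule assms in \<open>simp_all add: is_bimodule_def Let_def del: comp_assoc_arr\<close>)

lemma unit_elements: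
  assumes "f \<in> Arr C"
  shows "Cod C f = a \<Longrightarrow> m \<cdot> (u \<boxtimes> f) = f \<cdot> lunit C (Dom C f)"
    "Cod C f = a \<Longrightarrow> m \<cdot> (f \<boxtimes> u) = f \<cdot> runit C (Dom C f)"
    "Cod C f = x \<Longrightarrow> l \<cdot> (u \<boxtimes> f) = f \<cdot> lunit C (Dom C f)"
    "Cod C f = x \<Longrightarrow> r \<cdot> (f \<boxtimes> u) = f \<cdot> runit C (Dom C f)"
proof -
  show "m \<cdot> (u \<boxtimes> f) = f \<cdot> lunit C (Dom C f)" if "Cod C f = a"
    by (rule unit_left_elements[where X = a])
      (use algebra assms that in \<open>simp_all add: is_algebra_def Let_def\<close>)
  show "m \<cdot> (f \<boxtimes> u) = f \<cdot> runit C (Dom C f)" if "Cod C f = a"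
    by (rule unit_right_elements[where X = a])
      (use algebra assms that in \<open>simp_all add: is_algebra_def Let_def\<close>)
  show "l \<cdot> (u \<boxtimes> f) = f \<cdot> lunit C (Dom C f)" if "Cod C f = x"
    by (rule unit_left_elements[where X = x])
      (use bimodule assms that in \<open>simp_all add: is_bimodule_def Let_def\<close>)
  show "r \<cdot> (f \<boxtimes> u) = f \<cdot> runit C (Dom C f)" if "Cod C f = x"
    by (rule unit_right_elements[where X = x])
      (use bimodule assms that in \<open>simp_all add: is_bimodule_def Let_def\<close>)
qed

text \<open>An instance of Kelly's coherence law \<open>lunit \<I> = runit \<I>\<close>, here read off from the two unit laws of \<open>A\<close>.\<close>

lemma unit_lunit_runit: "u \<cdot> lunit C \<I> = u \<cdot> runit C \<I>"
  using unit_elements(1,2)[of u] by simp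

lemma Z2_iff:
  "\<omega> \<in> hoch_Z2 C A M \<longleftrightarrow> \<omega> \<in> Hom C (a \<odot> a) x \<and>
    l \<cdot> ((ident C a \<boxtimes> \<omega>) \<cdot> assoc C a a a) \<oplus> \<omega> \<cdot> ((ident C a \<boxtimes> m) \<cdot> assoc C a a a) =
    \<omega> \<cdot> (m \<boxtimes> ident C a) \<oplus> r \<cdot> (\<omega> \<boxtimes> ident C a)"
proof (cases "\<omega> \<in> Hom C (a \<odot> a) x")
  case True
  then have \<omega>: "\<omega> \<in> Arr C" "Dom C \<omega> = a \<odot> a" "Cod C \<omega> = x"
    by (auto simp: Hom_iff)
  show ?thesis
    using \<omega> alternating_sum_eq_zero_iff[of "l \<cdot> (ident C a \<boxtimes> \<omega>) \<cdot> assoc C a a a"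
        "\<omega> \<cdot> (m \<boxtimes> ident C a)" "\<omega> \<cdot> (ident C a \<boxtimes> m) \<cdot> assoc C a a a" "r \<cdot> (\<omega> \<boxtimes> ident C a)"]
    by (simp add: hoch_Z2_def kernel_def hoch_b2_def Let_def Hom_iff)
qed (auto simp: hoch_Z2_def kernel_def Let_def)

lemma Z2_arr:
  assumes "\<omega> \<in> hoch_Z2 C A M"
  shows "\<omega> \<in> Arr C" "Dom C \<omega> = a \<odot> a" "Cod C \<omega> = x"
  using assms by (auto simp: Z2_iff Hom_iff)

text \<open>Precomposing the cocycle identity with \<open>(f \<boxtimes> g) \<boxtimes> h\<close>
  and moving the associator past it by naturality evaluates the identity at (f,g,h). It is applied
  at (u,u,f), at (f,u,u) and at three copies of the projection onto A.\<close>

lemma cocycle_elements: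
  assumes Z: "\<omega> \<in> hoch_Z2 C A M"
    and arr: "f \<in> Arr C" "g \<in> Arr C" "h \<in> Arr C" "Cod C f = a" "Cod C g = a" "Cod C h = a"
  shows "l \<cdot> ((f \<boxtimes> (\<omega> \<cdot> (g \<boxtimes> h))) \<cdot> assoc C (Dom C f) (Dom C g) (Dom C h)) \<oplus>
      \<omega> \<cdot> ((f \<boxtimes> (m \<cdot> (g \<boxtimes> h))) \<cdot> assoc C (Dom C f) (Dom C g) (Dom C h)) =
    \<omega> \<cdot> ((m \<cdot> (f \<boxtimes> g)) \<boxtimes> h) \<oplus> r \<cdot> ((\<omega> \<cdot> (f \<boxtimes> g)) \<boxtimes> h)"
proof -
  note [simp] = Z2_arr[OF Z]
  have eq: "l \<cdot> ((ident C a \<boxtimes> \<omega>) \<cdot> assoc C a a a) \<oplus> \<omega> \<cdot> ((ident C a \<boxtimes> m) \<cdot> assoc C a a a) =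
    \<omega> \<cdot> (m \<boxtimes> ident C a) \<oplus> r \<cdot> (\<omega> \<boxtimes> ident C a)"
    using Z by (simp add: Z2_iff)
  have "(l \<cdot> ((ident C a \<boxtimes> \<omega>) \<cdot> assoc C a a a) \<oplus> \<omega> \<cdot> ((ident C a \<boxtimes> m) \<cdot> assoc C a a a)) \<cdot>
      ((f \<boxtimes> g) \<boxtimes> h) = (\<omega> \<cdot> (m \<boxtimes> ident C a) \<oplus> r \<cdot> (\<omega> \<boxtimes> ident C a)) \<cdot> ((f \<boxtimes> g) \<boxtimes> h)"
    by (simp only: eq)
  then show ?thesis
    using arr by (simp add: comp_distrib_left)
qed

text \<open>At (1,1,f) the cocycle identity reads \<omega>(1,f) + \<omega>(1,f) = \<omega>(1,f) +
  \<omega>(1,1)f, and one summand cancels. This is what makes the unit of \<open>E \<omega>\<close>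
  a left unit.\<close>

lemma cocycle_unit_left:
  assumes Z: "\<omega> \<in> hoch_Z2 C A M" and f: "f \<in> Arr C" "Cod C f = a"
  shows "r \<cdot> ((\<omega> \<cdot> ((u \<boxtimes> u) \<cdot> inv_arrow C (lunit C \<I>))) \<boxtimes> f) = \<omega> \<cdot> (u \<boxtimes> f)"
proof -
  note [simp] = Z2_arr[OF Z]
  let ?X = "Dom C f"
  let ?t = "\<omega> \<cdot> ((u \<cdot> lunit C \<I>) \<boxtimes> f)"
  have tri: "(ident C \<I> \<boxtimes> lunit C ?X) \<cdot> assoc C \<I> \<I> ?X = runit C \<I> \<boxtimes> ident C ?X"
    using f by (simp add: triangle)
  have 1: "(u \<boxtimes> (f \<cdot> lunit C ?X)) \<cdot> assoc C \<I> \<I> ?X = (u \<cdot> lunit C \<I>) \<boxtimes> f"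
  proof -
    have "(u \<boxtimes> f) \<cdot> ((ident C \<I> \<boxtimes> lunit C ?X) \<cdot> assoc C \<I> \<I> ?X) = (u \<cdot> lunit C \<I>) \<boxtimes> f"
      using f by (simp add: tri unit_lunit_runit del: tensor_comp_tail)
    then show ?thesis
      using f by simp
  qed
  \<comment> \<open>The unit law of the left action yields the constraint of
    \<open>\<I> \<odot> ?X\<close>; \<open>lunit_unit_tensor\<close> brings it into the shape to
    which the triangle applies.\<close>
  have 2: "l \<cdot> ((u \<boxtimes> (\<omega> \<cdot> (u \<boxtimes> f))) \<cdot> assoc C \<I> \<I> ?X) = ?t"
  proof -
    have "l \<cdot> ((u \<boxtimes> (\<omega> \<cdot> (u \<boxtimes> f))) \<cdot> assoc C \<I> \<I> ?X)
        = (l \<cdot> (u \<boxtimes> (\<omega> \<cdot> (u \<boxtimes> f)))) \<cdot> assoc C \<I> \<I> ?X"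
      using f by simp
    also have "\<dots> = \<omega> \<cdot> ((u \<boxtimes> f) \<cdot> ((ident C \<I> \<boxtimes> lunit C ?X) \<cdot> assoc C \<I> \<I> ?X))"
      using f by (simp add: unit_elements(3) lunit_unit_tensor del: tensor_comp_tail tensor_comp_arr)
    also have "\<dots> = ?t"
      using f 1 by simp
    finally show ?thesis .
  qed
  have "?t \<oplus> ?t = ?t \<oplus> r \<cdot> ((\<omega> \<cdot> (u \<boxtimes> u)) \<boxtimes> f)"
    using cocycle_elements[OF Z, of u u f] f 1 2 by (simp add: unit_elements unit_lunit_runit)
  then have "r \<cdot> ((\<omega> \<cdot> (u \<boxtimes> u)) \<boxtimes> f) = ?t"
    using f by (simp add: add_left_cancel_arr)
  \<comment> \<open>The first tensor factor still starts at \<open>\<I> \<odot> \<I>\<close>;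
    precomposing with the inverse constraint replaces this source by \<I>.\<close>
  then have "r \<cdot> ((\<omega> \<cdot> (u \<boxtimes> u)) \<boxtimes> f) \<cdot> (inv_arrow C (lunit C \<I>) \<boxtimes> ident C ?X)
      = ?t \<cdot> (inv_arrow C (lunit C \<I>) \<boxtimes> ident C ?X)"
    by simp
  then show ?thesis
    using f by simp
qed

text \<open>The mirror image, from (f,1,1): f\<omega>(1,1) + \<omega>(f,1) = \<omega>(f,1) +
  \<omega>(f,1).\<close>

lemma cocycle_unit_right:
  assumes Z: "\<omega> \<in> hoch_Z2 C A M" and f: "f \<in> Arr C" "Cod C f = a"
  shows "l \<cdot> (f \<boxtimes> (\<omega> \<cdot> ((u \<boxtimes> u) \<cdot> inv_arrow C (lunit C \<I>)))) = \<omega> \<cdot> (f \<boxtimes> u)"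
proof -
  note [simp] = Z2_arr[OF Z]
  let ?X = "Dom C f"
  let ?t = "\<omega> \<cdot> ((f \<cdot> runit C ?X) \<boxtimes> u)"
  have tri: "(ident C ?X \<boxtimes> lunit C \<I>) \<cdot> assoc C ?X \<I> \<I> = runit C ?X \<boxtimes> ident C \<I>"
    using f by (simp add: triangle)
  have 1: "(f \<boxtimes> (u \<cdot> lunit C \<I>)) \<cdot> assoc C ?X \<I> \<I> = (f \<cdot> runit C ?X) \<boxtimes> u"
  proof -
    have "(f \<boxtimes> u) \<cdot> ((ident C ?X \<boxtimes> lunit C \<I>) \<cdot> assoc C ?X \<I> \<I>) = (f \<cdot> runit C ?X) \<boxtimes> u"
      using f by (simp add: tri del: tensor_comp_tail)
    then show ?thesis
      using f by simp
  qed
  have 2: "r \<cdot> ((\<omega> \<cdot> (f \<boxtimes> u)) \<boxtimes> u) = ?t"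
    using f by (simp add: unit_elements(4) runit_tensor_unit)
  have "l \<cdot> ((f \<boxtimes> (\<omega> \<cdot> (u \<boxtimes> u))) \<cdot> assoc C ?X \<I> \<I>) \<oplus> ?t = ?t \<oplus> ?t"
    using cocycle_elements[OF Z, of f u u] f 1 2 by (simp add: unit_elements(1,2) unit_lunit_runit)
  then have "l \<cdot> ((f \<boxtimes> (\<omega> \<cdot> (u \<boxtimes> u))) \<cdot> assoc C ?X \<I> \<I>) = ?t"
    using f by (simp add: add_right_cancel_arr)
  \<comment> \<open>Here the associator stands next to the left action, so it survives. Writing
    \<open>?t\<close> with the same associator at its end allows it to be cancelled as an
    isomorphism.\<close>
  also have "\<dots> = \<omega> \<cdot> ((f \<boxtimes> (u \<cdot> lunit C \<I>)) \<cdot> assoc C ?X \<I> \<I>)"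
    by (simp only: 1)
  finally have "l \<cdot> (f \<boxtimes> (\<omega> \<cdot> (u \<boxtimes> u))) = \<omega> \<cdot> (f \<boxtimes> (u \<cdot> lunit C \<I>))"
    using f by (intro iso_cancel_right[of "assoc C ?X \<I> \<I>" "l \<cdot> (f \<boxtimes> (\<omega> \<cdot> (u \<boxtimes> u)))"]) simp_all
  then have "l \<cdot> (f \<boxtimes> (\<omega> \<cdot> (u \<boxtimes> u))) \<cdot> (ident C ?X \<boxtimes> inv_arrow C (lunit C \<I>))
      = \<omega> \<cdot> (f \<boxtimes> (u \<cdot> lunit C \<I>)) \<cdot> (ident C ?X \<boxtimes> inv_arrow C (lunit C \<I>))"
    by simp
  then show ?thesis
    using f by simp
qed

end

section \<open>Hochschild extensions and the cocycle of a section\<close>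

context hochschild_setting
begin

text \<open>The sign agrees with the -\<omega> in the multiplication of
  \<open>cocycle_extension\<close>, so that the first injection has cocycle \<omega> itself.
  Compatibility with the actions is absent because \<open>section_action\<close> supplies it for
  every section.\<close>

definition section_cocycle :: "('o, 'a) extension_data \<Rightarrow> 'a \<Rightarrow> 'a \<Rightarrow> bool" where
  "section_cocycle E \<sigma> \<omega> \<longleftrightarrow> \<sigma> \<in> Hom C a (alg_obj E) \<and> \<omega> \<in> Hom C (a \<odot> a) x \<and>
     ext_proj E \<cdot> \<sigma> = ident C a \<and> \<sigma> \<cdot> m = alg_mult E \<cdot> (\<sigma> \<boxtimes> \<sigma>) \<oplus> ext_incl E \<cdot> \<omega>"

end

locale hochschild_ext = hochschild_setting +
  fixes E
  assumes ext: "hochschild_extension C A M E"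
begin

abbreviation e where "e \<equiv> alg_obj E"
abbreviation m\<^sub>E where "m\<^sub>E \<equiv> alg_mult E"
abbreviation u\<^sub>E where "u\<^sub>E \<equiv> alg_unit E"
abbreviation \<pi> where "\<pi> \<equiv> ext_proj E"
abbreviation i where "i \<equiv> ext_incl E"

lemma ext_arr [simp]:
  "e \<in> Obj C" "m\<^sub>E \<in> Arr C" "Dom C m\<^sub>E = e \<odot> e" "Cod C m\<^sub>E = e" "u\<^sub>E \<in> Arr C" "Dom C u\<^sub>E = \<I>" "Cod C u\<^sub>E = e"
  "\<pi> \<in> Arr C" "Dom C \<pi> = e" "Cod C \<pi> = a" "i \<in> Arr C" "Dom C i = x" "Cod C i = e"
  using ext by (auto simp: hochschild_extension_def is_algebra_def algebra_hom_def Let_def Hom_iff)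

lemma proj_mult [simp]: "\<pi> \<cdot> m\<^sub>E = m \<cdot> (\<pi> \<boxtimes> \<pi>)"
  and proj_unit [simp]: "\<pi> \<cdot> u\<^sub>E = u"
  and proj_incl [simp]: "\<pi> \<cdot> i = Zero C x a"
  and mult_incl_incl: "m\<^sub>E \<cdot> (i \<boxtimes> i) = Zero C (x \<odot> x) e"
  using ext by (auto simp: hochschild_extension_def algebra_hom_def is_kernel_def Let_def)

lemma proj_mult_tail [simp]:
  assumes "f \<in> Arr C" "Cod C f = e \<odot> e"
  shows "\<pi> \<cdot> (m\<^sub>E \<cdot> f) = m \<cdot> ((\<pi> \<boxtimes> \<pi>) \<cdot> f)"
  using assms comp_assoc_arr[of f m\<^sub>E \<pi>] by simp

lemma proj_incl_tail [simp]:
  assumes "f \<in> Arr C" "Cod C f = x"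
  shows "\<pi> \<cdot> (i \<cdot> f) = Zero C (Dom C f) a"
  using assms comp_assoc_arr[of f i \<pi>] by simp

lemma ext_mult_assoc:
  assumes "f \<in> Arr C" "g \<in> Arr C" "h \<in> Arr C" "Cod C f = e" "Cod C g = e" "Cod C h = e"
  shows "m\<^sub>E \<cdot> ((m\<^sub>E \<cdot> (f \<boxtimes> g)) \<boxtimes> h) =
    m\<^sub>E \<cdot> ((f \<boxtimes> (m\<^sub>E \<cdot> (g \<boxtimes> h))) \<cdot> assoc C (Dom C f) (Dom C g) (Dom C h))"
  by (rule assoc_elements)
    (use ext assms in \<open>simp_all add: hochschild_extension_def is_algebra_def Let_def del: comp_assoc_arr\<close>)

lemma ext_unit_left:
  assumes "f \<in> Arr C" "Cod C f = e"
  shows "m\<^sub>E \<cdot> (u\<^sub>E \<boxtimes> f) = f \<cdot> lunit C (Dom C f)"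
  by (rule unit_left_elements[where X = e])
    (use ext assms in \<open>simp_all add: hochschild_extension_def is_algebra_def Let_def\<close>)

lemma ext_unit_right:
  assumes "f \<in> Arr C" "Cod C f = e"
  shows "m\<^sub>E \<cdot> (f \<boxtimes> u\<^sub>E) = f \<cdot> runit C (Dom C f)"
  by (rule unit_right_elements[where X = e])
    (use ext assms in \<open>simp_all add: hochschild_extension_def is_algebra_def Let_def\<close>)

lemma kernel_lift:
  assumes "h \<in> Arr C" "Cod C h = e" "\<pi> \<cdot> h = Zero C (Dom C h) a"
  obtains k where "k \<in> Arr C" "Dom C k = Dom C h" "Cod C k = x" "i \<cdot> k = h"
proof -
  have "\<forall>X \<in> Obj C. \<forall>h \<in> Hom C X e. \<pi> \<cdot> h = Zero C X a \<longrightarrow> (\<exists>!h'. h' \<in> Hom C X x \<and> i \<cdot> h' = h)"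
    using ext by (simp add: hochschild_extension_def is_kernel_def Let_def)
  moreover have "h \<in> Hom C (Dom C h) e" "Dom C h \<in> Obj C"
    using assms by (auto simp: Hom_iff)
  ultimately obtain k where "k \<in> Hom C (Dom C h) x" "i \<cdot> k = h"
    using assms(3) by blast
  then show thesis
    using that by (auto simp: Hom_iff)
qed

lemma incl_cancel:
  assumes "k \<in> Arr C" "k' \<in> Arr C" "Dom C k = Dom C k'" "Cod C k = x" "Cod C k' = x" "i \<cdot> k = i \<cdot> k'"
  shows "k = k'"
proof -
  have "\<forall>X \<in> Obj C. \<forall>h \<in> Hom C X e. \<pi> \<cdot> h = Zero C X a \<longrightarrow> (\<exists>!h'. h' \<in> Hom C X x \<and> i \<cdot> h' = h)"
    using ext by (simp add: hochschild_extension_def is_kernel_def Let_def)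
  moreover have "i \<cdot> k' \<in> Hom C (Dom C k') e" "Dom C k' \<in> Obj C" "\<pi> \<cdot> (i \<cdot> k') = Zero C (Dom C k') a"
    "k \<in> Hom C (Dom C k') x" "k' \<in> Hom C (Dom C k') x"
    using assms by (auto simp: Hom_iff)
  ultimately show ?thesis
    using assms(6) by blast
qed

text \<open>The difference f - g is killed by \<pi>, hence factors through its kernel. Every
  kernel-valued correction below is obtained in this way.\<close>

lemma proj_eq_decomp:
  assumes "f \<in> Arr C" "g \<in> Arr C" "Dom C f = Dom C g" "Cod C f = e" "Cod C g = e" "\<pi> \<cdot> f = \<pi> \<cdot> g"
  obtains k where "k \<in> Arr C" "Dom C k = Dom C g" "Cod C k = x" "f = g \<oplus> i \<cdot> k"
proof -
  have "\<pi> \<cdot> (f \<oplus> neg g) = Zero C (Dom C g) a"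
    using assms by (simp add: distribs)
  then obtain k where k: "k \<in> Arr C" "Dom C k = Dom C g" "Cod C k = x" "i \<cdot> k = f \<oplus> neg g"
    using assms kernel_lift[of "f \<oplus> neg g"] by auto
  then have "f = g \<oplus> i \<cdot> k"
    using assms add_neg_cancel(1)[of f g] add_commute_arr[of "f \<oplus> neg g" g] by simp
  with k show thesis
    using that by auto
qed

lemma mult_incl_incl_elements:
  assumes "f \<in> Arr C" "g \<in> Arr C" "Cod C f = x" "Cod C g = x"
  shows "m\<^sub>E \<cdot> ((i \<cdot> f) \<boxtimes> (i \<cdot> g)) = Zero C (Dom C f \<odot> Dom C g) e"
proof -
  have "m\<^sub>E \<cdot> (i \<boxtimes> i) \<cdot> (f \<boxtimes> g) = Zero C (Dom C f \<odot> Dom C g) e"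
    using assms by (simp add: mult_incl_incl del: comp_assoc_arr)
  then show ?thesis
    using assms by simp
qed

text \<open>An arbitrary section differs from the one provided by the definition of an extension by
  some \<open>i \<cdot> k\<close>, and the product of \<open>i \<cdot> k\<close> with
  \<open>i\<close> vanishes because the kernel squares to zero.\<close>

lemma section_action:
  assumes \<sigma>: "\<sigma> \<in> Hom C a e" "\<pi> \<cdot> \<sigma> = ident C a"
  shows "m\<^sub>E \<cdot> (\<sigma> \<boxtimes> i) = i \<cdot> l" "m\<^sub>E \<cdot> (i \<boxtimes> \<sigma>) = i \<cdot> r"
proof -
  obtain \<tau> where \<tau>: "\<tau> \<in> Arr C" "Dom C \<tau> = a" "Cod C \<tau> = e" "\<pi> \<cdot> \<tau> = ident C a"
    "i \<cdot> l = m\<^sub>E \<cdot> (\<tau> \<boxtimes> i)" "i \<cdot> r = m\<^sub>E \<cdot> (i \<boxtimes> \<tau>)"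
    using ext by (auto simp: hochschild_extension_def Let_def Hom_iff)
  obtain k where k: "k \<in> Arr C" "Dom C k = a" "Cod C k = x" "\<sigma> = \<tau> \<oplus> i \<cdot> k"
    using proj_eq_decomp[of \<sigma> \<tau>] \<sigma> \<tau> by (auto simp: Hom_iff)
  show "m\<^sub>E \<cdot> (\<sigma> \<boxtimes> i) = i \<cdot> l"
    using k \<tau> mult_incl_incl_elements[of k "ident C x"] by (simp add: distribs)
  show "m\<^sub>E \<cdot> (i \<boxtimes> \<sigma>) = i \<cdot> r"
    using k \<tau> mult_incl_incl_elements[of "ident C x" k] by (simp add: distribs)
qed

lemma section_action_left:
  assumes \<sigma>: "\<sigma> \<in> Hom C a e" "\<pi> \<cdot> \<sigma> = ident C a"
    and "f \<in> Arr C" "g \<in> Arr C" "Cod C f = a" "Cod C g = x"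
  shows "m\<^sub>E \<cdot> ((\<sigma> \<cdot> f) \<boxtimes> (i \<cdot> g)) = i \<cdot> (l \<cdot> (f \<boxtimes> g))"
proof -
  have "m\<^sub>E \<cdot> (\<sigma> \<boxtimes> i) \<cdot> (f \<boxtimes> g) = i \<cdot> l \<cdot> (f \<boxtimes> g)"
    by (simp only: section_action[OF \<sigma>])
  then show ?thesis
    using assms by (simp add: Hom_iff)
qed

lemma section_action_right:
  assumes \<sigma>: "\<sigma> \<in> Hom C a e" "\<pi> \<cdot> \<sigma> = ident C a"
    and "f \<in> Arr C" "g \<in> Arr C" "Cod C f = x" "Cod C g = a"
  shows "m\<^sub>E \<cdot> ((i \<cdot> f) \<boxtimes> (\<sigma> \<cdot> g)) = i \<cdot> (r \<cdot> (f \<boxtimes> g))"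
proof -
  have "m\<^sub>E \<cdot> (i \<boxtimes> \<sigma>) \<cdot> (f \<boxtimes> g) = i \<cdot> r \<cdot> (f \<boxtimes> g)"
    by (simp only: section_action[OF \<sigma>])
  then show ?thesis
    using assms by (simp add: Hom_iff)
qed

text \<open>Since \<pi> is multiplicative and \<sigma> is a section, both
  \<open>\<sigma> \<cdot> m\<close> and
  \<open>m\<^sub>E \<cdot> (\<sigma> \<boxtimes> \<sigma>)\<close> project to \<open>m\<close>;
  \<omega> is their difference, lifted to the kernel.\<close>

lemma ex_section_cocycle: "\<exists>\<sigma> \<omega>. section_cocycle E \<sigma> \<omega>"
proof -
  obtain \<sigma> where \<sigma>: "\<sigma> \<in> Arr C" "Dom C \<sigma> = a" "Cod C \<sigma> = e" "\<pi> \<cdot> \<sigma> = ident C a"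
    using ext by (auto simp: hochschild_extension_def Let_def Hom_iff)
  then have tail: "\<pi> \<cdot> (\<sigma> \<cdot> m) = m"
    using comp_assoc_arr[of m \<sigma> \<pi>] by simp
  obtain \<omega> where "\<omega> \<in> Arr C" "Dom C \<omega> = a \<odot> a" "Cod C \<omega> = x" "\<sigma> \<cdot> m = m\<^sub>E \<cdot> (\<sigma> \<boxtimes> \<sigma>) \<oplus> i \<cdot> \<omega>"
    using proj_eq_decomp[of "\<sigma> \<cdot> m" "m\<^sub>E \<cdot> (\<sigma> \<boxtimes> \<sigma>)"] \<sigma> tail by auto
  with \<sigma> show ?thesis
    by (auto simp: section_cocycle_def Hom_iff)
qed

context
  fixes \<sigma> \<omega>
  assumes sc: "section_cocycle E \<sigma> \<omega>"
begin

lemma section_cocycle_arr: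
  "\<sigma> \<in> Arr C" "Dom C \<sigma> = a" "Cod C \<sigma> = e" "\<omega> \<in> Arr C" "Dom C \<omega> = a \<odot> a" "Cod C \<omega> = x"
  "\<sigma> \<in> Hom C a e" "\<pi> \<cdot> \<sigma> = ident C a"
  using sc by (auto simp: section_cocycle_def Hom_iff)

lemma section_mult:
  assumes "f \<in> Arr C" "g \<in> Arr C" "Cod C f = a" "Cod C g = a"
  shows "\<sigma> \<cdot> (m \<cdot> (f \<boxtimes> g)) = m\<^sub>E \<cdot> ((\<sigma> \<cdot> f) \<boxtimes> (\<sigma> \<cdot> g)) \<oplus> i \<cdot> (\<omega> \<cdot> (f \<boxtimes> g))"
proof -
  have "\<sigma> \<cdot> m \<cdot> (f \<boxtimes> g) = (m\<^sub>E \<cdot> (\<sigma> \<boxtimes> \<sigma>) \<oplus> i \<cdot> \<omega>) \<cdot> (f \<boxtimes> g)"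
    using sc by (simp only: section_cocycle_def)
  then show ?thesis
    using assms section_cocycle_arr by (simp add: distribs)
qed

text \<open>\<sigma> of a triple product is expanded for both bracketings. Each expansion is the
  triple product \<open>?P\<close> of values of \<sigma> in E plus a term in the kernel. The left
  sides agree by associativity of A and the terms \<open>?P\<close> by associativity of E;
  cancelling \<open>?P\<close> and then the monic \<open>i\<close> leaves the cocycle
  identity.\<close>

lemma section_cocycle_Z2: "\<omega> \<in> hoch_Z2 C A M"
proof -
  note [simp] = section_cocycle_arr
  let ?I = "ident C a" and ?\<alpha> = "assoc C a a a"
  let ?P = "m\<^sub>E \<cdot> ((m\<^sub>E \<cdot> (\<sigma> \<boxtimes> \<sigma>)) \<boxtimes> \<sigma>)"
  have \<sigma>m: "\<sigma> \<cdot> m = m\<^sub>E \<cdot> (\<sigma> \<boxtimes> \<sigma>) \<oplus> i \<cdot> \<omega>"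
    using sc by (simp add: section_cocycle_def)
  have L: "\<sigma> \<cdot> (m \<cdot> (m \<boxtimes> ?I)) = ?P \<oplus> i \<cdot> (\<omega> \<cdot> (m \<boxtimes> ?I) \<oplus> r \<cdot> (\<omega> \<boxtimes> ?I))"
    using section_mult[of m ?I] section_action_right[of \<sigma> \<omega> ?I]
    by (simp add: \<sigma>m distribs add_ac_arr)
  have "\<sigma> \<cdot> (m \<cdot> (?I \<boxtimes> m)) = m\<^sub>E \<cdot> (\<sigma> \<boxtimes> (m\<^sub>E \<cdot> (\<sigma> \<boxtimes> \<sigma>))) \<oplus> i \<cdot> (l \<cdot> (?I \<boxtimes> \<omega>) \<oplus> \<omega> \<cdot> (?I \<boxtimes> m))"
    using section_mult[of ?I m] section_action_left[of \<sigma> ?I \<omega>]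
    by (simp add: \<sigma>m distribs add_ac_arr)
  then have "\<sigma> \<cdot> (m \<cdot> (?I \<boxtimes> m)) \<cdot> ?\<alpha>
      = (m\<^sub>E \<cdot> (\<sigma> \<boxtimes> (m\<^sub>E \<cdot> (\<sigma> \<boxtimes> \<sigma>))) \<oplus> i \<cdot> (l \<cdot> (?I \<boxtimes> \<omega>) \<oplus> \<omega> \<cdot> (?I \<boxtimes> m))) \<cdot> ?\<alpha>"
    by simp
  then have R: "\<sigma> \<cdot> (m \<cdot> ((?I \<boxtimes> m) \<cdot> ?\<alpha>)) =
      ?P \<oplus> i \<cdot> (l \<cdot> ((?I \<boxtimes> \<omega>) \<cdot> ?\<alpha>) \<oplus> \<omega> \<cdot> ((?I \<boxtimes> m) \<cdot> ?\<alpha>))"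
    using ext_mult_assoc[of \<sigma> \<sigma> \<sigma>] by (simp add: distribs)
  have "m \<cdot> (m \<boxtimes> ?I) = m \<cdot> ((?I \<boxtimes> m) \<cdot> ?\<alpha>)"
    using mult_assoc[of ?I ?I ?I] by simp
  then have "?P \<oplus> i \<cdot> (l \<cdot> ((?I \<boxtimes> \<omega>) \<cdot> ?\<alpha>) \<oplus> \<omega> \<cdot> ((?I \<boxtimes> m) \<cdot> ?\<alpha>)) =
      ?P \<oplus> i \<cdot> (\<omega> \<cdot> (m \<boxtimes> ?I) \<oplus> r \<cdot> (\<omega> \<boxtimes> ?I))"
    using L R by simp
  then have "i \<cdot> (l \<cdot> ((?I \<boxtimes> \<omega>) \<cdot> ?\<alpha>) \<oplus> \<omega> \<cdot> ((?I \<boxtimes> m) \<cdot> ?\<alpha>)) =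
      i \<cdot> (\<omega> \<cdot> (m \<boxtimes> ?I) \<oplus> r \<cdot> (\<omega> \<boxtimes> ?I))"
    by (subst (asm) add_left_cancel_arr) simp_all
  then have "l \<cdot> ((?I \<boxtimes> \<omega>) \<cdot> ?\<alpha>) \<oplus> \<omega> \<cdot> ((?I \<boxtimes> m) \<cdot> ?\<alpha>) = \<omega> \<cdot> (m \<boxtimes> ?I) \<oplus> r \<cdot> (\<omega> \<boxtimes> ?I)"
    by (rule incl_cancel[rotated 5]) simp_all
  then show ?thesis
    by (simp add: Z2_iff Hom_iff)
qed

text \<open>
  \<open>1 - \<sigma>(1)\<close> lies in the kernel and squares to zero; this expresses \<open>1\<close> through \<open>\<sigma>(1)\<close>.
\<close>

lemma section_unit: "u\<^sub>E = \<sigma> \<cdot> u \<oplus> i \<cdot> (\<omega> \<cdot> ((u \<boxtimes> u) \<cdot> inv_arrow C (lunit C \<I>)))"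
proof -
  note [simp] = section_cocycle_arr
  let ?L = "lunit C \<I>" and ?R = "runit C \<I>"
  have "\<pi> \<cdot> (\<sigma> \<cdot> u) = u"
    using comp_assoc_arr[of u \<sigma> \<pi>] by simp
  then obtain k where k [simp]: "k \<in> Arr C" "Dom C k = \<I>" "Cod C k = x" and uE: "u\<^sub>E = \<sigma> \<cdot> u \<oplus> i \<cdot> k"
    using proj_eq_decomp[of u\<^sub>E "\<sigma> \<cdot> u"] by auto
  \<comment> \<open>The left action of the unit on \<open>k\<close> produces the left constraint and
    the right action the right one. They are identified here by evaluating the square of the unit of
    E with both unit laws and removing the contribution of
    \<open>\<sigma> \<cdot> u\<close>.\<close>
  have "u\<^sub>E \<cdot> ?L = u\<^sub>E \<cdot> ?R"
    using ext_unit_left[of u\<^sub>E] ext_unit_right[of u\<^sub>E] by simp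
  then have "\<sigma> \<cdot> (u \<cdot> ?R) \<oplus> i \<cdot> (k \<cdot> ?L) = \<sigma> \<cdot> (u \<cdot> ?R) \<oplus> i \<cdot> (k \<cdot> ?R)"
    by (simp add: uE distribs unit_lunit_runit)
  then have "i \<cdot> (k \<cdot> ?L) = i \<cdot> (k \<cdot> ?R)"
    by (subst (asm) add_left_cancel_arr) simp_all
  then have k\<rho>: "k \<cdot> ?R = k \<cdot> ?L"
    by (rule incl_cancel[rotated 5, OF sym]) simp_all
  let ?S = "m\<^sub>E \<cdot> ((\<sigma> \<cdot> u) \<boxtimes> (\<sigma> \<cdot> u))"
  \<comment> \<open>The equation 11 = 1 is expanded for 1 = \<sigma>(1) + i(k): each mixed product
    gives i(k), the square of i(k) is zero, and \<sigma>(1)\<sigma>(1) = \<sigma>(1) -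
    i\<omega>(1,1). What remains is k = \<omega>(1,1), up to the unit constraint.\<close>
  have "m\<^sub>E \<cdot> ((\<sigma> \<cdot> u \<oplus> i \<cdot> k) \<boxtimes> (\<sigma> \<cdot> u \<oplus> i \<cdot> k)) = (\<sigma> \<cdot> u \<oplus> i \<cdot> k) \<cdot> ?L"
    using ext_unit_left[of u\<^sub>E] by (simp add: uE)
  moreover have "m\<^sub>E \<cdot> ((\<sigma> \<cdot> u \<oplus> i \<cdot> k) \<boxtimes> (\<sigma> \<cdot> u \<oplus> i \<cdot> k)) = ?S \<oplus> i \<cdot> (k \<cdot> ?L) \<oplus> i \<cdot> (k \<cdot> ?L)"
    using section_action_left[of \<sigma> u k] section_action_right[of \<sigma> k u] mult_incl_incl_elements[of k k]
      unit_elements(3,4)[of k] k\<rho>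
    by (simp add: distribs add_ac_arr)
  moreover have "(\<sigma> \<cdot> u \<oplus> i \<cdot> k) \<cdot> ?L = \<sigma> \<cdot> (u \<cdot> ?L) \<oplus> i \<cdot> (k \<cdot> ?L)"
    by (simp add: distribs)
  moreover have "\<sigma> \<cdot> (u \<cdot> ?L) = ?S \<oplus> i \<cdot> (\<omega> \<cdot> (u \<boxtimes> u))"
    using section_mult[of u u] unit_elements(1)[of u] by simp
  ultimately have "?S \<oplus> i \<cdot> (k \<cdot> ?L) \<oplus> i \<cdot> (k \<cdot> ?L) = ?S \<oplus> i \<cdot> (\<omega> \<cdot> (u \<boxtimes> u)) \<oplus> i \<cdot> (k \<cdot> ?L)"
    by simp
  then have "i \<cdot> (k \<cdot> ?L) = i \<cdot> (\<omega> \<cdot> (u \<boxtimes> u))"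
    by (simp add: add_left_cancel_arr add_right_cancel_arr)
  then have "k \<cdot> ?L = \<omega> \<cdot> (u \<boxtimes> u)"
    by (rule incl_cancel[rotated 5]) simp_all
  then have "k \<cdot> ?L \<cdot> inv_arrow C ?L = \<omega> \<cdot> (u \<boxtimes> u) \<cdot> inv_arrow C ?L"
    by simp
  then have "k = \<omega> \<cdot> ((u \<boxtimes> u) \<cdot> inv_arrow C ?L)"
    by simp
  with uE show ?thesis
    by simp
qed

end

end

section \<open>Equivalence of extensions\<close>

context hochschild_setting
begin

lemma extension_equivE:
  assumes "(E, E') \<in> extension_equiv C A M"
  obtains f where "hochschild_ext C A M E" "hochschild_ext C A M E'" "f \<in> Arr C"
    "Dom C f = alg_obj E" "Cod C f = alg_obj E'" "f \<cdot> alg_mult E = alg_mult E' \<cdot> (f \<boxtimes> f)"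
    "f \<cdot> alg_unit E = alg_unit E'" "ext_proj E' \<cdot> f = ext_proj E" "f \<cdot> ext_incl E = ext_incl E'"
  using assms
  by (auto simp: extension_equiv_def algebra_hom_def Hom_iff
      intro!: hochschild_ext.intro hochschild_ext_axioms.intro hochschild_setting_axioms)

lemma extension_equivI:
  assumes "hochschild_ext C A M E" "hochschild_ext C A M E'" "f \<in> Arr C"
    "Dom C f = alg_obj E" "Cod C f = alg_obj E'" "f \<cdot> alg_mult E = alg_mult E' \<cdot> (f \<boxtimes> f)"
    "f \<cdot> alg_unit E = alg_unit E'" "ext_proj E' \<cdot> f = ext_proj E" "f \<cdot> ext_incl E = ext_incl E'"
  shows "(E, E') \<in> extension_equiv C A M"
  using assms by (auto simp: extension_equiv_def algebra_hom_def Hom_iff dest: hochschild_ext.ext)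

text \<open>The transported section is \<open>f \<cdot> \<sigma>\<close>; as \<open>f\<close>
  carries one inclusion exactly to the other, the defect is given by the same \<omega>.\<close>

lemma extension_equiv_section_cocycle:
  assumes EE': "(E, E') \<in> extension_equiv C A M" and sc: "section_cocycle E \<sigma> \<omega>"
  shows "\<exists>\<tau>. section_cocycle E' \<tau> \<omega>"
proof -
  from EE' obtain f where E: "hochschild_ext C A M E" and E': "hochschild_ext C A M E'"
    and f [simp]: "f \<in> Arr C" "Dom C f = alg_obj E" "Cod C f = alg_obj E'"
    and fm: "f \<cdot> alg_mult E = alg_mult E' \<cdot> (f \<boxtimes> f)"
    and \<pi>f: "ext_proj E' \<cdot> f = ext_proj E" and fi: "f \<cdot> ext_incl E = ext_incl E'"
    by (rule extension_equivE)
  interpret E: hochschild_ext C A M E by (fact E)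
  interpret E': hochschild_ext C A M E' by (fact E')
  note [simp] = E.section_cocycle_arr[OF sc]
  have "f \<cdot> (\<sigma> \<cdot> m) = f \<cdot> (alg_mult E \<cdot> (\<sigma> \<boxtimes> \<sigma>) \<oplus> ext_incl E \<cdot> \<omega>)"
    using sc by (simp only: section_cocycle_def)
  also have "\<dots> = (f \<cdot> alg_mult E) \<cdot> (\<sigma> \<boxtimes> \<sigma>) \<oplus> (f \<cdot> ext_incl E) \<cdot> \<omega>"
    by (simp add: distribs)
  also have "\<dots> = alg_mult E' \<cdot> ((f \<cdot> \<sigma>) \<boxtimes> (f \<cdot> \<sigma>)) \<oplus> ext_incl E' \<cdot> \<omega>"
    by (simp add: fm fi)
  finally have "f \<cdot> (\<sigma> \<cdot> m) = alg_mult E' \<cdot> ((f \<cdot> \<sigma>) \<boxtimes> (f \<cdot> \<sigma>)) \<oplus> ext_incl E' \<cdot> \<omega>" .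
  moreover have "ext_proj E' \<cdot> (f \<cdot> \<sigma>) = ident C a"
    using comp_assoc_arr[of \<sigma> f "ext_proj E'"] by (simp add: \<pi>f)
  ultimately have "section_cocycle E' (f \<cdot> \<sigma>) \<omega>"
    by (simp add: section_cocycle_def Hom_iff)
  then show ?thesis ..
qed

text \<open>This is the short five lemma for split extensions: a right inverse \<open>g\<close> of
  \<open>f\<close> is built from a section, \<open>f\<close> is shown to be monic, and
  \<open>g\<close> inherits the required properties from \<open>f\<close>.\<close>

lemma extension_equiv_sym:
  assumes "(E, E') \<in> extension_equiv C A M"
  shows "(E', E) \<in> extension_equiv C A M"
proof -
  from assms obtain f where E: "hochschild_ext C A M E" and E': "hochschild_ext C A M E'"
    and f [simp]: "f \<in> Arr C" "Dom C f = alg_obj E" "Cod C f = alg_obj E'"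
    and fm: "f \<cdot> alg_mult E = alg_mult E' \<cdot> (f \<boxtimes> f)" and fu: "f \<cdot> alg_unit E = alg_unit E'"
    and \<pi>f: "ext_proj E' \<cdot> f = ext_proj E" and fi: "f \<cdot> ext_incl E = ext_incl E'"
    by (rule extension_equivE)
  interpret E: hochschild_ext C A M E by (fact E)
  interpret E': hochschild_ext C A M E' by (fact E')
  obtain \<sigma> \<omega> where sc: "section_cocycle E \<sigma> \<omega>"
    using E.ex_section_cocycle by blast
  note [simp] = E.section_cocycle_arr[OF sc]
  have \<pi>f': "ext_proj E' \<cdot> (f \<cdot> t) = ext_proj E \<cdot> t" if "t \<in> Arr C" "Cod C t = E.e" for t
    using that comp_assoc_arr[of t f "ext_proj E'"] by (simp add: \<pi>f)
  have fi': "f \<cdot> (ext_incl E \<cdot> t) = ext_incl E' \<cdot> t" if "t \<in> Arr C" "Cod C t = x" for t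
    using that comp_assoc_arr[of t "ext_incl E" f] by (simp add: fi)
  have \<pi>\<sigma>': "ext_proj E \<cdot> (\<sigma> \<cdot> t) = t" if "t \<in> Arr C" "Cod C t = a" for t
    using that comp_assoc_arr[of t \<sigma> "ext_proj E"] by simp
  \<comment> \<open>In elements: y and f(\<sigma>(\<pi>'(y))) have the same projection, so they
    differ by i'(k(y)). Since \<open>f\<close> is the identity on M, g(y) = \<sigma>(\<pi>'(y)) +
    i(k(y)) is a preimage of y.\<close>
  have "ext_proj E' \<cdot> ident C E'.e = ext_proj E' \<cdot> (f \<cdot> (\<sigma> \<cdot> ext_proj E'))"
    by (simp add: \<pi>f' \<pi>\<sigma>')
  then obtain k where k [simp]: "k \<in> Arr C" "Dom C k = E'.e" "Cod C k = x"
    and decomp: "ident C E'.e = f \<cdot> (\<sigma> \<cdot> ext_proj E') \<oplus> ext_incl E' \<cdot> k"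
    using E'.proj_eq_decomp[of "ident C E'.e" "f \<cdot> (\<sigma> \<cdot> ext_proj E')"] by auto
  define g where "g = \<sigma> \<cdot> ext_proj E' \<oplus> ext_incl E \<cdot> k"
  have g [simp]: "g \<in> Arr C" "Dom C g = E'.e" "Cod C g = E.e"
    by (simp_all add: g_def)
  have fg: "f \<cdot> g = ident C E'.e"
    by (simp add: g_def distribs fi' decomp)
  \<comment> \<open>If \<open>f \<cdot> s = f \<cdot> t\<close>, then s and t have the same
    projection, so s = t + ij. Applying \<open>f\<close> gives i'j = 0, hence j = 0.\<close>
  have mono: "s = t" if [simp]: "s \<in> Arr C" "t \<in> Arr C" "Dom C s = Dom C t" "Cod C s = E.e" "Cod C t = E.e"
    and eq: "f \<cdot> s = f \<cdot> t" for s t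
  proof -
    have "ext_proj E \<cdot> s = ext_proj E \<cdot> t"
      using \<pi>f'[of s] \<pi>f'[of t] by (simp add: eq)
    then obtain j where j [simp]: "j \<in> Arr C" "Dom C j = Dom C t" "Cod C j = x" and s: "s = t \<oplus> ext_incl E \<cdot> j"
      using E.proj_eq_decomp[of s t] by auto
    have "f \<cdot> t \<oplus> ext_incl E' \<cdot> j = f \<cdot> t \<oplus> ext_incl E' \<cdot> Zero C (Dom C t) x"
      using eq by (simp add: s distribs fi')
    then have "ext_incl E' \<cdot> j = ext_incl E' \<cdot> Zero C (Dom C t) x"
      by (subst (asm) add_left_cancel_arr) simp_all
    then have "j = Zero C (Dom C t) x"
      by (rule E'.incl_cancel[rotated 5]) simp_all
    then show ?thesis
      using s by simp
  qed
  have fg': "f \<cdot> (g \<cdot> t) = t" if "t \<in> Arr C" "Cod C t = E'.e" for t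
    using that comp_assoc_arr[of t g f] by (simp add: fg)
  have fm': "f \<cdot> (alg_mult E \<cdot> t) = alg_mult E' \<cdot> ((f \<boxtimes> f) \<cdot> t)" if "t \<in> Arr C" "Cod C t = E.e \<odot> E.e" for t
    using that comp_assoc_arr[of t "alg_mult E" f] by (simp add: fm)
  \<comment> \<open>The multiplication, unit and inclusion equations for \<open>g\<close> are
    checked after composing with the monic \<open>f\<close>, where \<open>fg\<close> reduces them to
    those for \<open>f\<close>.\<close>
  show ?thesis
  proof (rule extension_equivI[OF E' E g])
    show "g \<cdot> alg_mult E' = alg_mult E \<cdot> (g \<boxtimes> g)"
      by (rule mono) (simp_all add: fg' fm' fg)
    show "g \<cdot> alg_unit E' = alg_unit E"
      by (rule mono) (simp_all add: fg' fu)
    show "ext_proj E \<cdot> g = ext_proj E'"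
      using \<pi>f'[of g] by (simp add: fg)
    show "g \<cdot> ext_incl E' = ext_incl E"
      by (rule mono) (simp_all add: fg' fi)
  qed
qed

lemma extension_equiv_trans:
  assumes "(E, E') \<in> extension_equiv C A M" "(E', E'') \<in> extension_equiv C A M"
  shows "(E, E'') \<in> extension_equiv C A M"
proof -
  from assms(1) obtain f where E: "hochschild_ext C A M E" and E': "hochschild_ext C A M E'"
    and f [simp]: "f \<in> Arr C" "Dom C f = alg_obj E" "Cod C f = alg_obj E'"
    and f_eqs: "f \<cdot> alg_mult E = alg_mult E' \<cdot> (f \<boxtimes> f)" "f \<cdot> alg_unit E = alg_unit E'"
      "ext_proj E' \<cdot> f = ext_proj E" "f \<cdot> ext_incl E = ext_incl E'"
    by (rule extension_equivE)
  from assms(2) obtain g where E'': "hochschild_ext C A M E''"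
    and g [simp]: "g \<in> Arr C" "Dom C g = alg_obj E'" "Cod C g = alg_obj E''"
    and g_eqs: "g \<cdot> alg_mult E' = alg_mult E'' \<cdot> (g \<boxtimes> g)" "g \<cdot> alg_unit E' = alg_unit E''"
      "ext_proj E'' \<cdot> g = ext_proj E'" "g \<cdot> ext_incl E' = ext_incl E''"
    by (rule extension_equivE)
  interpret E: hochschild_ext C A M E by (fact E)
  interpret E': hochschild_ext C A M E' by (fact E')
  interpret E'': hochschild_ext C A M E'' by (fact E'')
  show ?thesis
  proof (rule extension_equivI[OF E E'', of "g \<cdot> f"])
    show "g \<cdot> f \<cdot> alg_mult E = alg_mult E'' \<cdot> ((g \<cdot> f) \<boxtimes> (g \<cdot> f))"
      using comp_assoc_arr[of "f \<boxtimes> f" E'.m\<^sub>E g] by (simp add: f_eqs g_eqs)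
    show "ext_proj E'' \<cdot> (g \<cdot> f) = ext_proj E"
      using comp_assoc_arr[of f g "ext_proj E''"] by (simp add: f_eqs g_eqs)
  qed (simp_all add: f_eqs g_eqs)
qed

lemma extension_equiv_refl:
  assumes "hochschild_extension C A M E"
  shows "(E, E) \<in> extension_equiv C A M"
proof -
  interpret E: hochschild_ext C A M E
    by (intro hochschild_ext.intro hochschild_ext_axioms.intro hochschild_setting_axioms assms)
  show ?thesis
    by (rule extension_equivI[OF E.hochschild_ext_axioms E.hochschild_ext_axioms, of "ident C E.e"]) simp_all
qed

lemma equiv_extension_equiv: "equiv {E. hochschild_extension C A M E} (extension_equiv C A M)"
proof (rule equivI)
  show "extension_equiv C A M \<subseteq> {E. hochschild_extension C A M E} \<times> {E. hochschild_extension C A M E}"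
    by (auto simp: extension_equiv_def)
  show "refl_on {E. hochschild_extension C A M E} (extension_equiv C A M)"
    by (auto simp: refl_on_def intro: extension_equiv_refl)
  show "sym (extension_equiv C A M)"
    by (auto intro: symI extension_equiv_sym)
  show "trans (extension_equiv C A M)"
    by (auto intro: transI extension_equiv_trans)
qed

end

section \<open>The extension attached to a cocycle\<close>

locale hochschild_sum = hochschild_setting +
  fixes S
  assumes biproduct: "is_biproduct C (alg_obj A) (bim_obj M) S"
begin

abbreviation s where "s \<equiv> sum_obj S"
abbreviation i\<^sub>A where "i\<^sub>A \<equiv> inj1 S"
abbreviation i\<^sub>M where "i\<^sub>M \<equiv> inj2 S"
abbreviation p\<^sub>A where "p\<^sub>A \<equiv> proj1 S"
abbreviation p\<^sub>M where "p\<^sub>M \<equiv> proj2 S"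
abbreviation E where "E \<equiv> cocycle_extension C A M S"

lemma sum_arr [simp]:
  "s \<in> Obj C" "i\<^sub>A \<in> Arr C" "Dom C i\<^sub>A = a" "Cod C i\<^sub>A = s" "i\<^sub>M \<in> Arr C" "Dom C i\<^sub>M = x" "Cod C i\<^sub>M = s"
  "p\<^sub>A \<in> Arr C" "Dom C p\<^sub>A = s" "Cod C p\<^sub>A = a" "p\<^sub>M \<in> Arr C" "Dom C p\<^sub>M = s" "Cod C p\<^sub>M = x"
  using biproduct by (auto simp: is_biproduct_def Hom_iff)

lemma sum_comp [simp]:
  "p\<^sub>A \<cdot> i\<^sub>A = ident C a" "p\<^sub>M \<cdot> i\<^sub>M = ident C x" "p\<^sub>A \<cdot> i\<^sub>M = Zero C x a" "p\<^sub>M \<cdot> i\<^sub>A = Zero C a x"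
  using biproduct by (auto simp: is_biproduct_def)

lemma sum_comp_tail [simp]:
  assumes "t \<in> Arr C"
  shows "Cod C t = a \<Longrightarrow> p\<^sub>A \<cdot> (i\<^sub>A \<cdot> t) = t" "Cod C t = x \<Longrightarrow> p\<^sub>M \<cdot> (i\<^sub>M \<cdot> t) = t"
    "Cod C t = x \<Longrightarrow> p\<^sub>A \<cdot> (i\<^sub>M \<cdot> t) = Zero C (Dom C t) a"
    "Cod C t = a \<Longrightarrow> p\<^sub>M \<cdot> (i\<^sub>A \<cdot> t) = Zero C (Dom C t) x"
  using assms comp_assoc_arr[of t i\<^sub>A p\<^sub>A] comp_assoc_arr[of t i\<^sub>M p\<^sub>A] comp_assoc_arr[of t i\<^sub>A p\<^sub>M]
    comp_assoc_arr[of t i\<^sub>M p\<^sub>M] by simp_all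

lemma sum_eqI:
  assumes "f \<in> Arr C" "g \<in> Arr C" "Dom C f = Dom C g" "Cod C f = s" "Cod C g = s"
    "p\<^sub>A \<cdot> f = p\<^sub>A \<cdot> g" "p\<^sub>M \<cdot> f = p\<^sub>M \<cdot> g"
  shows "f = g"
proof -
  have sum: "i\<^sub>A \<cdot> p\<^sub>A \<oplus> i\<^sub>M \<cdot> p\<^sub>M = ident C s"
    using biproduct by (simp add: is_biproduct_def)
  have "h = i\<^sub>A \<cdot> (p\<^sub>A \<cdot> h) \<oplus> i\<^sub>M \<cdot> (p\<^sub>M \<cdot> h)" if "h \<in> Arr C" "Cod C h = s" for h
    using that arg_cong[OF sum, of "\<lambda>z. z \<cdot> h"] by (simp add: distribs)
  from this[of f] this[of g] show ?thesis
    using assms by simp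
qed

lemma inj2_kernel_proj1: "is_kernel C i\<^sub>M p\<^sub>A"
proof -
  have "\<exists>!h'. h' \<in> Hom C X x \<and> i\<^sub>M \<cdot> h' = h"
    if h: "h \<in> Hom C X s" "p\<^sub>A \<cdot> h = Zero C X a" for X h
  proof (rule ex1I[of _ "p\<^sub>M \<cdot> h"])
    have "i\<^sub>M \<cdot> (p\<^sub>M \<cdot> h) = h"
      by (rule sum_eqI) (use h in \<open>auto simp: Hom_iff\<close>)
    then show "p\<^sub>M \<cdot> h \<in> Hom C X x \<and> i\<^sub>M \<cdot> (p\<^sub>M \<cdot> h) = h"
      using h by (auto simp: Hom_iff)
    show "h' = p\<^sub>M \<cdot> h" if "h' \<in> Hom C X x \<and> i\<^sub>M \<cdot> h' = h" for h'
      using that by (auto simp: Hom_iff)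
  qed
  then show ?thesis
    by (simp add: is_kernel_def)
qed

lemma cocycle_extension_simps [simp]:
  "alg_obj (E \<omega>) = s" "ext_proj (E \<omega>) = p\<^sub>A" "ext_incl (E \<omega>) = i\<^sub>M"
  by (simp_all add: cocycle_extension_def Let_def)

context
  fixes \<omega>
  assumes \<omega>: "\<omega> \<in> hoch_Z2 C A M"
begin

abbreviation m\<^sub>\<omega> where "m\<^sub>\<omega> \<equiv> alg_mult (E \<omega>)"
abbreviation u\<^sub>\<omega> where "u\<^sub>\<omega> \<equiv> alg_unit (E \<omega>)"

lemma cocycle_extension_arr [simp]:
  "m\<^sub>\<omega> \<in> Arr C" "Dom C m\<^sub>\<omega> = s \<odot> s" "Cod C m\<^sub>\<omega> = s" "u\<^sub>\<omega> \<in> Arr C" "Dom C u\<^sub>\<omega> = \<I>" "Cod C u\<^sub>\<omega> = s"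
  using Z2_arr[OF \<omega>] by (simp_all add: cocycle_extension_def Let_def Diff_eq)

text \<open>In elements this is (b,y)(b',y') = (bb', yb' + by' - \<omega>(b,b')) and 1 = (1,
  \<omega>(1,1)). By \<open>sum_eqI\<close>, identities in \<open>E \<omega>\<close> reduce to these
  two components.\<close>

lemma cocycle_extension_proj:
  "p\<^sub>A \<cdot> m\<^sub>\<omega> = m \<cdot> (p\<^sub>A \<boxtimes> p\<^sub>A)"
  "p\<^sub>M \<cdot> m\<^sub>\<omega> = r \<cdot> (p\<^sub>M \<boxtimes> p\<^sub>A) \<oplus> l \<cdot> (p\<^sub>A \<boxtimes> p\<^sub>M) \<oplus> neg (\<omega> \<cdot> (p\<^sub>A \<boxtimes> p\<^sub>A))"
  "p\<^sub>A \<cdot> u\<^sub>\<omega> = u"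
  "p\<^sub>M \<cdot> u\<^sub>\<omega> = \<omega> \<cdot> ((u \<boxtimes> u) \<cdot> inv_arrow C (lunit C \<I>))"
  using Z2_arr[OF \<omega>] by (simp_all add: cocycle_extension_def Let_def Diff_eq distribs)

lemma cocycle_extension_proj_tail:
  assumes "f \<in> Arr C" "g \<in> Arr C" "Cod C f = s" "Cod C g = s"
  shows "p\<^sub>A \<cdot> (m\<^sub>\<omega> \<cdot> (f \<boxtimes> g)) = m \<cdot> ((p\<^sub>A \<cdot> f) \<boxtimes> (p\<^sub>A \<cdot> g))"
    "p\<^sub>M \<cdot> (m\<^sub>\<omega> \<cdot> (f \<boxtimes> g)) = r \<cdot> ((p\<^sub>M \<cdot> f) \<boxtimes> (p\<^sub>A \<cdot> g)) \<oplus> l \<cdot> ((p\<^sub>A \<cdot> f) \<boxtimes> (p\<^sub>M \<cdot> g)) \<oplus>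
      neg (\<omega> \<cdot> ((p\<^sub>A \<cdot> f) \<boxtimes> (p\<^sub>A \<cdot> g)))"
  using assms Z2_arr[OF \<omega>] comp_assoc_arr[of "f \<boxtimes> g" m\<^sub>\<omega> p\<^sub>A] comp_assoc_arr[of "f \<boxtimes> g" m\<^sub>\<omega> p\<^sub>M]
  by (simp_all add: cocycle_extension_proj distribs)

lemma cocycle_extension_assoc:
  "m\<^sub>\<omega> \<cdot> (m\<^sub>\<omega> \<boxtimes> ident C s) = m\<^sub>\<omega> \<cdot> ((ident C s \<boxtimes> m\<^sub>\<omega>) \<cdot> assoc C s s s)"
proof -
  note [simp] = Z2_arr[OF \<omega>]
  let ?\<alpha> = "assoc C s s s"
  \<comment> \<open>Isolating \<open>?\<alpha>\<close> on the right lets the components of the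
    remaining product be computed first, by \<open>cocycle_extension_proj_tail\<close>.\<close>
  have tail: "p \<cdot> (m\<^sub>\<omega> \<cdot> ((ident C s \<boxtimes> m\<^sub>\<omega>) \<cdot> ?\<alpha>)) = (p \<cdot> (m\<^sub>\<omega> \<cdot> (ident C s \<boxtimes> m\<^sub>\<omega>))) \<cdot> ?\<alpha>"
    if "p \<in> Arr C" "Dom C p = s" for p
    using that by simp
  have coc: "l \<cdot> ((p\<^sub>A \<boxtimes> (\<omega> \<cdot> (p\<^sub>A \<boxtimes> p\<^sub>A))) \<cdot> ?\<alpha>) \<oplus> \<omega> \<cdot> ((p\<^sub>A \<boxtimes> (m \<cdot> (p\<^sub>A \<boxtimes> p\<^sub>A))) \<cdot> ?\<alpha>) =
      \<omega> \<cdot> ((m \<cdot> (p\<^sub>A \<boxtimes> p\<^sub>A)) \<boxtimes> p\<^sub>A) \<oplus> r \<cdot> ((\<omega> \<cdot> (p\<^sub>A \<boxtimes> p\<^sub>A)) \<boxtimes> p\<^sub>A)"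
    using cocycle_elements[OF \<omega>, of p\<^sub>A p\<^sub>A p\<^sub>A] by simp
  \<comment> \<open>\<open>?B\<close> collects the terms free of \<omega>; the right, middle and
    left associativity laws of the bimodule match them on both sides. The remaining terms are
    matched by \<open>coc\<close>.\<close>
  let ?B = "r \<cdot> ((r \<cdot> (p\<^sub>M \<boxtimes> p\<^sub>A)) \<boxtimes> p\<^sub>A) \<oplus> r \<cdot> ((l \<cdot> (p\<^sub>A \<boxtimes> p\<^sub>M)) \<boxtimes> p\<^sub>A) \<oplus> l \<cdot> ((m \<cdot> (p\<^sub>A \<boxtimes> p\<^sub>A)) \<boxtimes> p\<^sub>M)"
  have L: "p\<^sub>M \<cdot> (m\<^sub>\<omega> \<cdot> (m\<^sub>\<omega> \<boxtimes> ident C s)) = ?B \<oplus>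
      neg (\<omega> \<cdot> ((m \<cdot> (p\<^sub>A \<boxtimes> p\<^sub>A)) \<boxtimes> p\<^sub>A) \<oplus> r \<cdot> ((\<omega> \<cdot> (p\<^sub>A \<boxtimes> p\<^sub>A)) \<boxtimes> p\<^sub>A))"
    by (simp add: cocycle_extension_proj_tail cocycle_extension_proj distribs neg_add_distrib add_ac_arr)
  have R: "p\<^sub>M \<cdot> (m\<^sub>\<omega> \<cdot> (ident C s \<boxtimes> m\<^sub>\<omega>)) \<cdot> ?\<alpha> = ?B \<oplus>
      neg (l \<cdot> ((p\<^sub>A \<boxtimes> (\<omega> \<cdot> (p\<^sub>A \<boxtimes> p\<^sub>A))) \<cdot> ?\<alpha>) \<oplus> \<omega> \<cdot> ((p\<^sub>A \<boxtimes> (m \<cdot> (p\<^sub>A \<boxtimes> p\<^sub>A))) \<cdot> ?\<alpha>))"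
    by (simp add: cocycle_extension_proj_tail cocycle_extension_proj distribs neg_add_distrib add_ac_arr
        right_assoc middle_assoc left_assoc)
  show ?thesis
  proof (rule sum_eqI)
    show "p\<^sub>A \<cdot> (m\<^sub>\<omega> \<cdot> (m\<^sub>\<omega> \<boxtimes> ident C s)) = p\<^sub>A \<cdot> (m\<^sub>\<omega> \<cdot> ((ident C s \<boxtimes> m\<^sub>\<omega>) \<cdot> ?\<alpha>))"
      unfolding tail[OF sum_arr(8,9)]
      by (simp add: cocycle_extension_proj_tail cocycle_extension_proj mult_assoc)
    show "p\<^sub>M \<cdot> (m\<^sub>\<omega> \<cdot> (m\<^sub>\<omega> \<boxtimes> ident C s)) = p\<^sub>M \<cdot> (m\<^sub>\<omega> \<cdot> ((ident C s \<boxtimes> m\<^sub>\<omega>) \<cdot> ?\<alpha>))"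
      unfolding tail[OF sum_arr(11,12)] L R coc ..
  qed simp_all
qed

text \<open>The M-component of 1(b,y) is \<omega>(1,1)b + y - \<omega>(1,b), where the outer terms
  cancel by \<open>cocycle_unit_left\<close>; symmetrically on the other side.\<close>

lemma cocycle_extension_unit:
  "m\<^sub>\<omega> \<cdot> (u\<^sub>\<omega> \<boxtimes> ident C s) = lunit C s" "m\<^sub>\<omega> \<cdot> (ident C s \<boxtimes> u\<^sub>\<omega>) = runit C s"
proof -
  note [simp] = Z2_arr[OF \<omega>]
  show "m\<^sub>\<omega> \<cdot> (u\<^sub>\<omega> \<boxtimes> ident C s) = lunit C s"
  proof (rule sum_eqI)
    show "p\<^sub>M \<cdot> (m\<^sub>\<omega> \<cdot> (u\<^sub>\<omega> \<boxtimes> ident C s)) = p\<^sub>M \<cdot> lunit C s"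
      using cocycle_unit_left[OF \<omega>, of p\<^sub>A] add_neg_cancel(2)[of "p\<^sub>M \<cdot> lunit C s" "\<omega> \<cdot> (u \<boxtimes> p\<^sub>A)"]
      by (simp add: cocycle_extension_proj_tail cocycle_extension_proj unit_elements add_ac_arr)
  qed (simp_all add: cocycle_extension_proj_tail cocycle_extension_proj unit_elements)
  show "m\<^sub>\<omega> \<cdot> (ident C s \<boxtimes> u\<^sub>\<omega>) = runit C s"
  proof (rule sum_eqI)
    show "p\<^sub>M \<cdot> (m\<^sub>\<omega> \<cdot> (ident C s \<boxtimes> u\<^sub>\<omega>)) = p\<^sub>M \<cdot> runit C s"
      using cocycle_unit_right[OF \<omega>, of p\<^sub>A] add_neg_cancel(2)[of "p\<^sub>M \<cdot> runit C s" "\<omega> \<cdot> (p\<^sub>A \<boxtimes> u)"]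
      by (simp add: cocycle_extension_proj_tail cocycle_extension_proj unit_elements add_ac_arr)
  qed (simp_all add: cocycle_extension_proj_tail cocycle_extension_proj unit_elements)
qed

lemma cocycle_extension_ext: "hochschild_ext C A M (E \<omega>)"
proof (intro hochschild_ext.intro hochschild_ext_axioms.intro hochschild_setting_axioms)
  note [simp] = Z2_arr[OF \<omega>]
  have "m\<^sub>\<omega> \<cdot> (i\<^sub>M \<boxtimes> i\<^sub>M) = Zero C (x \<odot> x) s" "i\<^sub>M \<cdot> l = m\<^sub>\<omega> \<cdot> (i\<^sub>A \<boxtimes> i\<^sub>M)" "i\<^sub>M \<cdot> r = m\<^sub>\<omega> \<cdot> (i\<^sub>M \<boxtimes> i\<^sub>A)"
    by (rule sum_eqI; simp add: cocycle_extension_proj_tail)+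
  then show "hochschild_extension C A M (E \<omega>)"
    using cocycle_extension_assoc cocycle_extension_unit inj2_kernel_proj1
    by (auto simp: hochschild_extension_def is_algebra_def algebra_hom_def Let_def Hom_iff
        cocycle_extension_proj intro!: bexI[of _ i\<^sub>A])
qed

end

end

section \<open>Coboundaries and cohomology classes\<close>

context hochschild_setting
begin

lemma b1_arr [simp]:
  assumes "g \<in> Arr C" "Dom C g = a" "Cod C g = x"
  shows "hoch_b1 C A M g \<in> Arr C" "Dom C (hoch_b1 C A M g) = a \<odot> a" "Cod C (hoch_b1 C A M g) = x"
  using assms by (simp_all add: hoch_b1_def Diff_eq)

lemma B2_subgroup: "subgroup (hoch_B2 C A M) (hom_group C (a \<odot> a) x)"
proof -
  have "hoch_b1 C A M \<in> hom (hom_group C a x) (hom_group C (a \<odot> a) x)"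
    by (rule homI) (auto simp: Hom_iff hoch_b1_def Diff_eq distribs neg_add_distrib add_ac_arr)
  then have "group_hom (hom_group C a x) (hom_group C (a \<odot> a) x) (hoch_b1 C A M)"
    by (intro group_hom.intro group_hom_axioms.intro comm_group.axioms(2) hom_comm_group) simp_all
  from group_hom.img_is_subgroup[OF this] show ?thesis
    by (simp add: hoch_B2_def)
qed

text \<open>A right coset depends only on the multiplication, which the cocycle group shares with
  the full hom-group. Hence the coset calculus can be carried out there, with
  \<open>B2_subgroup\<close>.\<close>

lemma hoch_class_eq_iff:
  assumes \<omega>: "\<omega> \<in> Hom C (a \<odot> a) x" and \<omega>': "\<omega>' \<in> Hom C (a \<odot> a) x"
  shows "hoch_class C A M \<omega> = hoch_class C A M \<omega>' \<longleftrightarrow> (\<exists>g \<in> Hom C a x. \<omega>' = hoch_b1 C A M g \<oplus> \<omega>)"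
proof -
  let ?G = "hom_group C (a \<odot> a) x"
  interpret G: comm_group ?G
    by (rule hom_comm_group) simp_all
  have coset: "hoch_class C A M \<omega> = hoch_B2 C A M #>\<^bsub>?G\<^esub> \<omega>" for \<omega>
    by (simp add: hoch_class_def r_coset_def hoch_Z2_group_def)
  have "hoch_class C A M \<omega> = hoch_class C A M \<omega>' \<longleftrightarrow> \<omega>' \<in> hoch_B2 C A M #>\<^bsub>?G\<^esub> \<omega>"
    unfolding coset using G.repr_independence[OF _ _ B2_subgroup] G.rcos_self[OF _ B2_subgroup] \<omega> \<omega>'
    by auto
  then show ?thesis
    by (auto simp: r_coset_def hoch_B2_def)
qed

end

section \<open>Cohomologous cocycles and equivalent extensions\<close>

context hochschild_sum
begin

text \<open>The M-component of the defining equation reads gm = r(g,1) + l(1,g) - \<omega> +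
  \<omega>', which is the claim after moving \<open>\<omega>\<close> and \<open>g \<cdot> m\<close>
  across.\<close>

lemma section_cocycle_shift:
  assumes \<omega>: "\<omega> \<in> hoch_Z2 C A M" and \<omega>': "\<omega>' \<in> Hom C (a \<odot> a) x" and g: "g \<in> Hom C a x"
  shows "section_cocycle (E \<omega>) (i\<^sub>A \<oplus> i\<^sub>M \<cdot> g) \<omega>' \<longleftrightarrow> \<omega> = hoch_b1 C A M g \<oplus> \<omega>'"
proof -
  have [simp]: "\<omega> \<in> Arr C" "Dom C \<omega> = a \<odot> a" "Cod C \<omega> = x" "g \<in> Arr C" "Dom C g = a" "Cod C g = x"
    "\<omega>' \<in> Arr C" "Dom C \<omega>' = a \<odot> a" "Cod C \<omega>' = x"
    using \<omega>' g Z2_arr[OF \<omega>] by (auto simp: Hom_iff)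
  note [simp] = cocycle_extension_arr[OF \<omega>]
  let ?\<sigma> = "i\<^sub>A \<oplus> i\<^sub>M \<cdot> g" and ?R = "r \<cdot> (g \<boxtimes> ident C a)" and ?L = "l \<cdot> (ident C a \<boxtimes> g)"
  let ?m = "alg_mult (E \<omega>)"
  \<comment> \<open>The A-component holds for every \<open>g\<close>, both sides being
    \<open>m\<close>, so the whole condition sits in the M-component.\<close>
  have A: "p\<^sub>A \<cdot> (?\<sigma> \<cdot> m) = p\<^sub>A \<cdot> (?m \<cdot> (?\<sigma> \<boxtimes> ?\<sigma>) \<oplus> i\<^sub>M \<cdot> \<omega>')"
    using cocycle_extension_proj_tail(1)[OF \<omega>, of ?\<sigma> ?\<sigma>]
    by (simp add: comp_distrib_left comp_distrib_right)
  have M: "p\<^sub>M \<cdot> (?\<sigma> \<cdot> m) = g \<cdot> m"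
    "p\<^sub>M \<cdot> (?m \<cdot> (?\<sigma> \<boxtimes> ?\<sigma>) \<oplus> i\<^sub>M \<cdot> \<omega>') = ?R \<oplus> ?L \<oplus> neg \<omega> \<oplus> \<omega>'"
    using cocycle_extension_proj_tail(2)[OF \<omega>, of ?\<sigma> ?\<sigma>]
    by (simp_all add: comp_distrib_left comp_distrib_right)
  have "section_cocycle (E \<omega>) ?\<sigma> \<omega>' \<longleftrightarrow> ?\<sigma> \<cdot> m = ?m \<cdot> (?\<sigma> \<boxtimes> ?\<sigma>) \<oplus> i\<^sub>M \<cdot> \<omega>'"
    by (simp add: section_cocycle_def Hom_iff comp_distrib_right)
  also have "\<dots> \<longleftrightarrow> g \<cdot> m = ?R \<oplus> ?L \<oplus> neg \<omega> \<oplus> \<omega>'"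
    unfolding M[symmetric] using A by (auto intro!: sum_eqI[of "?\<sigma> \<cdot> m"])
  also have "?R \<oplus> ?L \<oplus> neg \<omega> \<oplus> \<omega>' = ?R \<oplus> ?L \<oplus> \<omega>' \<oplus> neg \<omega>"
    by (simp add: add_ac_arr)
  also have "g \<cdot> m = ?R \<oplus> ?L \<oplus> \<omega>' \<oplus> neg \<omega> \<longleftrightarrow> g \<cdot> m \<oplus> \<omega> = ?R \<oplus> ?L \<oplus> \<omega>'"
    by (rule eq_add_neg_iff) simp_all
  also have "\<dots> \<longleftrightarrow> \<omega> \<oplus> g \<cdot> m = ?R \<oplus> ?L \<oplus> \<omega>'"
    by (simp add: add_commute_arr[of "g \<cdot> m" \<omega>])
  also have "\<dots> \<longleftrightarrow> \<omega> = ?R \<oplus> ?L \<oplus> \<omega>' \<oplus> neg (g \<cdot> m)"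
    by (rule eq_add_neg_iff[symmetric]) simp_all
  also have "?R \<oplus> ?L \<oplus> \<omega>' \<oplus> neg (g \<cdot> m) = hoch_b1 C A M g \<oplus> \<omega>'"
    by (simp add: hoch_b1_def Diff_eq add_ac_arr)
  finally show ?thesis .
qed

lemma section_cocycle_inj1:
  assumes \<omega>: "\<omega> \<in> hoch_Z2 C A M"
  shows "section_cocycle (E \<omega>) i\<^sub>A \<omega>"
  using section_cocycle_shift[OF \<omega>, of \<omega> "Zero C a x"] Z2_arr[OF \<omega>]
  by (simp add: Hom_iff hoch_b1_def Diff_eq)

lemma cocycle_extension_equiv:
  assumes E': "hochschild_extension C A M E'" and sc: "section_cocycle E' \<sigma> \<omega>"
  shows "(E \<omega>, E') \<in> extension_equiv C A M"
proof -
  interpret E': hochschild_ext C A M E'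
    by (intro hochschild_ext.intro hochschild_ext_axioms.intro hochschild_setting_axioms E')
  note [simp] = E'.section_cocycle_arr[OF sc]
  have \<omega>: "\<omega> \<in> hoch_Z2 C A M"
    using sc by (rule E'.section_cocycle_Z2)
  interpret E: hochschild_ext C A M "E \<omega>"
    using \<omega> by (rule cocycle_extension_ext)
  let ?f = "\<sigma> \<cdot> p\<^sub>A \<oplus> E'.i \<cdot> p\<^sub>M"
  have tail: "E'.\<pi> \<cdot> (\<sigma> \<cdot> p\<^sub>A) = p\<^sub>A"
    using comp_assoc_arr[of p\<^sub>A \<sigma> E'.\<pi>] by simp
  show ?thesis
  proof (rule extension_equivI[OF E.hochschild_ext_axioms E'.hochschild_ext_axioms, of ?f])
    have "E'.m\<^sub>E \<cdot> (?f \<boxtimes> ?f) = E'.m\<^sub>E \<cdot> ((\<sigma> \<cdot> p\<^sub>A) \<boxtimes> (\<sigma> \<cdot> p\<^sub>A)) \<oplus>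
        (E'.i \<cdot> (r \<cdot> (p\<^sub>M \<boxtimes> p\<^sub>A)) \<oplus> E'.i \<cdot> (l \<cdot> (p\<^sub>A \<boxtimes> p\<^sub>M)))"
      using E'.section_action_left[of \<sigma> p\<^sub>A p\<^sub>M] E'.section_action_right[of \<sigma> p\<^sub>M p\<^sub>A]
        E'.mult_incl_incl_elements[of p\<^sub>M p\<^sub>M]
      by (simp add: distribs add_ac_arr)
    \<comment> \<open>\<sigma> applied to a product in A contributes +i\<omega>, and the
      multiplication of \<open>E \<omega>\<close> contributes -i\<omega>. \<open>add_neg\<close> is
      disabled to keep this pair visible until the end.\<close>
    moreover have "?f \<cdot> alg_mult (E \<omega>) = (E'.m\<^sub>E \<cdot> ((\<sigma> \<cdot> p\<^sub>A) \<boxtimes> (\<sigma> \<cdot> p\<^sub>A)) \<oplus>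
        (E'.i \<cdot> (r \<cdot> (p\<^sub>M \<boxtimes> p\<^sub>A)) \<oplus> E'.i \<cdot> (l \<cdot> (p\<^sub>A \<boxtimes> p\<^sub>M)))) \<oplus>
        (E'.i \<cdot> (\<omega> \<cdot> (p\<^sub>A \<boxtimes> p\<^sub>A)) \<oplus> neg (E'.i \<cdot> (\<omega> \<cdot> (p\<^sub>A \<boxtimes> p\<^sub>A))))"
      using E'.section_mult[OF sc, of p\<^sub>A p\<^sub>A] cocycle_extension_arr[OF \<omega>]
      by (simp add: distribs cocycle_extension_proj[OF \<omega>] add_ac_arr del: add_neg)
    ultimately show "?f \<cdot> alg_mult (E \<omega>) = E'.m\<^sub>E \<cdot> (?f \<boxtimes> ?f)"
      by simp
    show "?f \<cdot> alg_unit (E \<omega>) = E'.u\<^sub>E"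
      using E'.section_unit[OF sc] cocycle_extension_arr[OF \<omega>]
      by (simp add: comp_distrib_left cocycle_extension_proj[OF \<omega>])
    show "E'.\<pi> \<cdot> ?f = ext_proj (E \<omega>)"
      by (simp add: comp_distrib_right tail)
    show "?f \<cdot> ext_incl (E \<omega>) = E'.i"
      by (simp add: comp_distrib_left)
  qed simp_all
qed

text \<open>Both sides express that \<open>E \<omega>'\<close> has a section with cocycle \<omega>.
  An equivalence transports the first injection of \<open>E \<omega>\<close> to such a section; any
  such section is a shift by some \<open>g\<close>, to which \<open>section_cocycle_shift\<close>
  applies.\<close>

lemma cocycle_extension_equiv_iff:
  assumes \<omega>: "\<omega> \<in> hoch_Z2 C A M" and \<omega>': "\<omega>' \<in> hoch_Z2 C A M"
  shows "(E \<omega>, E \<omega>') \<in> extension_equiv C A M \<longleftrightarrow> (\<exists>g \<in> Hom C a x. \<omega>' = hoch_b1 C A M g \<oplus> \<omega>)"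
proof
  interpret E': hochschild_ext C A M "E \<omega>'"
    using \<omega>' by (rule cocycle_extension_ext)
  have \<omega>_Hom: "\<omega> \<in> Hom C (a \<odot> a) x"
    using \<omega> by (simp add: Z2_iff)
  {
    assume "(E \<omega>, E \<omega>') \<in> extension_equiv C A M"
    then obtain \<sigma> where sc: "section_cocycle (E \<omega>') \<sigma> \<omega>"
      using extension_equiv_section_cocycle[OF _ section_cocycle_inj1[OF \<omega>]] by blast
    obtain g where g: "g \<in> Arr C" "Dom C g = a" "Cod C g = x" "\<sigma> = i\<^sub>A \<oplus> i\<^sub>M \<cdot> g"
      using E'.proj_eq_decomp[of \<sigma> i\<^sub>A] E'.section_cocycle_arr[OF sc] by auto
    then show "\<exists>g \<in> Hom C a x. \<omega>' = hoch_b1 C A M g \<oplus> \<omega>"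
      using section_cocycle_shift[OF \<omega>' \<omega>_Hom, of g] sc by (auto simp: Hom_iff)
  next
    assume "\<exists>g \<in> Hom C a x. \<omega>' = hoch_b1 C A M g \<oplus> \<omega>"
    then obtain g where "g \<in> Hom C a x" "\<omega>' = hoch_b1 C A M g \<oplus> \<omega>"
      by blast
    then have "section_cocycle (E \<omega>') (i\<^sub>A \<oplus> i\<^sub>M \<cdot> g) \<omega>"
      using section_cocycle_shift[OF \<omega>' \<omega>_Hom] by blast
    then show "(E \<omega>, E \<omega>') \<in> extension_equiv C A M"
      using E'.ext by (rule cocycle_extension_equiv[rotated])
  }
qed

text \<open>From right to left this makes \<Phi> well defined, from left to right injective.\<close>

lemma Ext_class_eq_iff:
  assumes \<omega>: "\<omega> \<in> hoch_Z2 C A M" and \<omega>': "\<omega>' \<in> hoch_Z2 C A M"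
  shows "Ext_class C A M (E \<omega>) = Ext_class C A M (E \<omega>') \<longleftrightarrow> hoch_class C A M \<omega> = hoch_class C A M \<omega>'"
proof -
  have "Ext_class C A M (E \<omega>) = Ext_class C A M (E \<omega>') \<longleftrightarrow> (E \<omega>, E \<omega>') \<in> extension_equiv C A M"
    unfolding Ext_class_def using assms
    by (intro eq_equiv_class_iff[OF equiv_extension_equiv]) (auto dest: cocycle_extension_ext hochschild_ext.ext)
  then show ?thesis
    using assms by (simp add: cocycle_extension_equiv_iff hoch_class_eq_iff Z2_iff)
qed

lemma Ext_set_eq: "Ext_set C A M = (\<lambda>\<omega>. Ext_class C A M (E \<omega>)) ` hoch_Z2 C A M"
proof -
  have "Ext_class C A M E' \<in> (\<lambda>\<omega>. Ext_class C A M (E \<omega>)) ` hoch_Z2 C A M"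
    if E': "hochschild_extension C A M E'" for E'
  proof -
    interpret E': hochschild_ext C A M E'
      by (intro hochschild_ext.intro hochschild_ext_axioms.intro hochschild_setting_axioms E')
    obtain \<sigma> \<omega> where sc: "section_cocycle E' \<sigma> \<omega>"
      using E'.ex_section_cocycle by blast
    then have "Ext_class C A M (E \<omega>) = Ext_class C A M E'"
      unfolding Ext_class_def by (intro equiv_class_eq[OF equiv_extension_equiv] cocycle_extension_equiv[OF E'])
    with E'.section_cocycle_Z2[OF sc] show ?thesis
      by force
  qed
  then show ?thesis
    by (auto simp: Ext_set_def quotient_def Ext_class_def dest: cocycle_extension_ext[THEN hochschild_ext.ext])
qed

end

theorem theorem2p20:
  fixes C :: "('o, 'a) mon_cat"
    and A :: "('o, 'a) algebra_data"
    and M :: "('o, 'a) bimodule_data"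
    and S :: "('o, 'a) sum_diagram"
  assumes "abelian_monoidal_category C"
    and "is_algebra C A"
    and "is_bimodule C A M"
    and "is_biproduct C (alg_obj A) (bim_obj M) S"
  shows "\<exists>\<Phi>. (\<forall>\<omega> \<in> hoch_Z2 C A M.
            \<Phi> (hoch_class C A M \<omega>) = Ext_class C A M (cocycle_extension C A M S \<omega>)) \<and>
          bij_betw \<Phi> (carrier (hoch_H2 C A M)) (Ext_set C A M)"
proof -
  interpret hochschild_sum C A M S
    using assms by (intro hochschild_sum.intro hochschild_setting.intro hochschild_setting_axioms.intro
        hochschild_sum_axioms.intro)
  \<comment> \<open>A cohomology class is sent to the extension of a chosen representative;
    \<open>Ext_class_eq_iff\<close> makes the value independent of the choice.\<close>
  define \<Phi> where "\<Phi> c = Ext_class C A M (E (SOME \<omega>. \<omega> \<in> hoch_Z2 C A M \<and> hoch_class C A M \<omega> = c))" for c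
  have \<Phi>: "\<Phi> (hoch_class C A M \<omega>) = Ext_class C A M (E \<omega>)" if \<omega>: "\<omega> \<in> hoch_Z2 C A M" for \<omega>
  proof -
    let ?P = "\<lambda>\<omega>'. \<omega>' \<in> hoch_Z2 C A M \<and> hoch_class C A M \<omega>' = hoch_class C A M \<omega>"
    have "?P (SOME \<omega>'. ?P \<omega>')"
      by (rule someI[of ?P \<omega>]) (use \<omega> in simp)
    then show ?thesis
      unfolding \<Phi>_def using \<omega> by (subst Ext_class_eq_iff) simp_all
  qed
  have H2: "carrier (hoch_H2 C A M) = hoch_class C A M ` hoch_Z2 C A M"
    by (auto simp: hoch_H2_def FactGroup_def RCOSETS_def hoch_class_def hoch_Z2_group_def)
  have "bij_betw \<Phi> (carrier (hoch_H2 C A M)) (Ext_set C A M)"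
    unfolding bij_betw_def H2 Ext_set_eq
    by (auto simp: inj_on_def image_image \<Phi> Ext_class_eq_iff)
  with \<Phi> show ?thesis
    by blast
qed

end
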